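(* Let $\sigma>1$ and let $\varphi\in C^\infty(\mathbb R)$. Call a pair of sequences $(\alpha_n)_{n\in\mathbb N_0}$, $(\beta_m)_{m\in\mathbb N_0}$ admissible if both are strictly increasing sequences of non-negative integers tending to infinity, $\alpha_0=\beta_0=0$, and there is $L>1$ such that $\alpha_{n+1}/\alpha_n\le L$ and $\beta_{n+1}/\beta_n\le L$ for all $n\in\mathbb N=\{1,2,\dots\}$. Then the following conditions are equivalent: 1. $\varphi\in\mathcal S_{(\mathcal M_\sigma)}^{(\mathcal M_\sigma)}(\mathbb R)$. 2. There exists an admissible pair $(\alpha_n)$, $(\beta_m)$ such that for every $\tau>0$ there exists $C>0$ such that for all $m,n\in\mathbb N_0$ $$\sup_{x\in\mathbb R}|x^{\alpha_n}\varphi(x)|\le C M_{\alpha_n}^{\tau,\sigma}\quad\text{and}\quad \sup_{x\in\mathbb R}|\varphi^{(\beta_m)}(x)|\le C M_{\beta_m}^{\tau,\sigma}.$$ 3. There exists an admissible pair $(\alpha_n)$, $(\beta_m)$ such that for every $\tau>0$ there exists $C>0$ such that for all $m,n\in\mathbb N_0$ $$\sup_{x\in\mathbb R}|x^{\alpha_n}\varphi(x)|\le C M_{\alpha_n}^{\tau,\sigma}\quad\text{and}\quad \sup_{\xi\in\mathbb R}|\xi^{\beta_m}\widehat\varphi(\xi)|\le C M_{\beta_m}^{\tau,\sigma}.$$ 4. There exists an admissible pair $(\alpha_n)$, $(\beta_m)$ such that for every $\tau>0$ there exists $C>0$ such that for all $m,n\in\mathbb N_0$ $$\sup_{\xi\in\mathbb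 R}|\widehat\varphi^{(\alpha_n)}(\xi)|\le C M_{\alpha_n}^{\tau,\sigma}\quad\text{and}\quad \sup_{\xi\in\mathbb R}|\xi^{\beta_m}\widehat\varphi(\xi)|\le C M_{\beta_m}^{\tau,\sigma}.$$ 5. There exists an admissible pair $(\alpha_n)$, $(\beta_m)$ such that for every $\tau>0$ $$\sup_{x\in\mathbb R}|\varphi(x)|e^{T_{\tau,\sigma,(\alpha_n)}(|x|)}<\infty\quad\text{and}\quad \sup_{\xi\in\mathbb R}|\widehat\varphi(\xi)|e^{T_{\tau,\sigma,(\beta_n)}(|\xi|)}<\infty .$$
   Context: $\mathbb N_0=\{0,1,2,\dots\}$. For $\tau>0$, $\sigma>1$ put $M_0^{\tau,\sigma}=1$ and $M_n^{\tau,\sigma}=n^{\tau n^\sigma}$ for integers $n\ge1$; the weight matrix is $\mathcal M_\sigma=\{(M_n^{\tau,\sigma})_{n\in\mathbb N_0}:\tau>0\}$. The extended Gelfand--Shilov space of Beurling type $\mathcal S_{(\mathcal M_\sigma)}^{(\mathcal M_\sigma)}(\mathbb R)$ is the set of all $\varphi\in C^\infty(\mathbb R)$ such that for every $\tau>0$ there exists $C>0$ with $\sup_{x\in\mathbb R}|x^\alpha\varphi^{(\beta)}(x)|\le C M_\alpha^{\tau,\sigma}M_\beta^{\tau,\sigma}$ for all $\alpha,\beta\in\mathbb N_0$. For a sequence $(d_n)_{n\in\mathbb N_0}$ of non-negative integers with $d_0=0$ and $d_n\to\infty$, $$T_{\tau,\sigma,(d_n)}(x)=\sup_{n\in\mathbb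 N_0}\ln\frac{x^{d_n}}{M_{d_n}^{\tau,\sigma}},\qquad x\ge0$$ (with $0^0=1$). $\widehat\varphi$ denotes the Fourier transform of $\varphi$, given for $\varphi$ in the extended Gelfand--Shilov space by $\widehat\varphi(\xi)=\int_{\mathbb R}\varphi(x)e^{-2\pi i x\xi}\,dx$, $\xi\in\mathbb R$. *)

theory Defs
  imports "HOL-Analysis.Analysis"
begin

definition weight :: "real \<Rightarrow> real \<Rightarrow> nat \<Rightarrow> real" where
  "weight \<tau> \<sigma> n = (if n = 0 then 1 else real n powr (\<tau> * real n powr \<sigma>))"

definition nth_deriv :: "nat \<Rightarrow> (real \<Rightarrow> complex) \<Rightarrow> real \<Rightarrow> complex" where
  "nth_deriv n f = ((\<lambda>g x. vector_derivative g (at x)) ^^ n) f"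

text \<open>All iterated derivatives exist everywhere; their continuity follows from the existence
  of the next one.\<close>

definition smooth :: "(real \<Rightarrow> complex) \<Rightarrow> bool" where
  "smooth f \<longleftrightarrow> (\<forall>n x. nth_deriv n f differentiable (at x))"

text \<open>Here and below, an estimate \<open>sup\<^sub>x g x \<le> K\<close> is written as \<open>\<forall>x. g x \<le> K\<close>.\<close>

definition gelfand_shilov :: "real \<Rightarrow> (real \<Rightarrow> complex) set" where
  "gelfand_shilov \<sigma> =
     {\<phi>. smooth \<phi> \<and>
        (\<forall>\<tau>>0. \<exists>C>0. \<forall>a b. \<forall>x.
           norm (of_real (x ^ a) * nth_deriv b \<phi> x) \<le> C * weight \<tau> \<sigma> a * weight \<tau> \<sigma> b)}"

text \<open>Meaningful only for integrable \<open>\<phi>\<close>: the Bochner integral of a non-integrable function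
  is \<open>0\<close> by convention.\<close>

definition fourier :: "(real \<Rightarrow> complex) \<Rightarrow> real \<Rightarrow> complex" where
  "fourier \<phi> \<xi> = (LINT x|lborel. \<phi> x * exp (- (2 * of_real pi * \<i> * of_real x * of_real \<xi>)))"

text \<open>The supremum is that of a bounded set for \<open>\<tau> > 0\<close>, \<open>\<sigma> > 1\<close>, because
  \<open>weight \<tau> \<sigma> n\<close> eventually dominates \<open>x ^ n\<close>. At \<open>x = 0\<close> the convention \<open>ln 0 = 0\<close> replaces
  the value \<open>-\<infinity>\<close>; the supremum is \<open>0\<close> either way, because the term at \<open>n = 0\<close> is
  \<open>ln 1 = 0\<close> when \<open>d 0 = 0\<close>.\<close>

definition assoc_fun :: "real \<Rightarrow> real \<Rightarrow> (nat \<Rightarrow> nat) \<Rightarrow> real \<Rightarrow> real" where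
  "assoc_fun \<tau> \<sigma> d x = (SUP n. ln (x ^ d n / weight \<tau> \<sigma> (d n)))"

definition admissible :: "(nat \<Rightarrow> nat) \<Rightarrow> (nat \<Rightarrow> nat) \<Rightarrow> bool" where
  "admissible \<alpha> \<beta> \<longleftrightarrow>
     strict_mono \<alpha> \<and> strict_mono \<beta> \<and>
     filterlim \<alpha> at_top sequentially \<and> filterlim \<beta> at_top sequentially \<and>
     \<alpha> 0 = 0 \<and> \<beta> 0 = 0 \<and>
     (\<exists>L::real. L > 1 \<and>
        (\<forall>n\<ge>1. real (\<alpha> (Suc n)) / real (\<alpha> n) \<le> L \<and> real (\<beta> (Suc n)) / real (\<beta> n) \<le> L))"

definition cond_decay_deriv :: "real \<Rightarrow> (real \<Rightarrow> complex) \<Rightarrow> bool" where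
  "cond_decay_deriv \<sigma> \<phi> \<longleftrightarrow>
     (\<exists>\<alpha> \<beta>. admissible \<alpha> \<beta> \<and>
        (\<forall>\<tau>>0. \<exists>C>0. \<forall>m n.
           (\<forall>x. norm (of_real (x ^ \<alpha> n) * \<phi> x) \<le> C * weight \<tau> \<sigma> (\<alpha> n)) \<and>
           (\<forall>x. norm (nth_deriv (\<beta> m) \<phi> x) \<le> C * weight \<tau> \<sigma> (\<beta> m))))"

text \<open>No integrability of \<open>\<phi>\<close> is demanded in the next condition, nor in
  \<open>cond_assoc_fun\<close>: there the first estimate implies it for continuous \<open>\<phi>\<close>.\<close>

definition cond_decay_decay :: "real \<Rightarrow> (real \<Rightarrow> complex) \<Rightarrow> bool" where
  "cond_decay_decay \<sigma> \<phi> \<longleftrightarrow>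
     (\<exists>\<alpha> \<beta>. admissible \<alpha> \<beta> \<and>
        (\<forall>\<tau>>0. \<exists>C>0. \<forall>m n.
           (\<forall>x. norm (of_real (x ^ \<alpha> n) * \<phi> x) \<le> C * weight \<tau> \<sigma> (\<alpha> n)) \<and>
           (\<forall>\<xi>. norm (of_real (\<xi> ^ \<beta> m) * fourier \<phi> \<xi>) \<le> C * weight \<tau> \<sigma> (\<beta> m))))"

text \<open>This condition only bounds the Fourier transform and its derivatives, so that these exist
  has to be part of it. Without integrability of \<open>\<phi>\<close> every non-integrable function would satisfy
  it with \<open>fourier \<phi> = 0\<close>.\<close>

definition cond_fourier :: "real \<Rightarrow> (real \<Rightarrow> complex) \<Rightarrow> bool" where
  "cond_fourier \<sigma> \<phi> \<longleftrightarrow>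
     integrable lborel \<phi> \<and> smooth (fourier \<phi>) \<and>
     (\<exists>\<alpha> \<beta>. admissible \<alpha> \<beta> \<and>
        (\<forall>\<tau>>0. \<exists>C>0. \<forall>m n.
           (\<forall>\<xi>. norm (nth_deriv (\<alpha> n) (fourier \<phi>) \<xi>) \<le> C * weight \<tau> \<sigma> (\<alpha> n)) \<and>
           (\<forall>\<xi>. norm (of_real (\<xi> ^ \<beta> m) * fourier \<phi> \<xi>) \<le> C * weight \<tau> \<sigma> (\<beta> m))))"

definition cond_assoc_fun :: "real \<Rightarrow> (real \<Rightarrow> complex) \<Rightarrow> bool" where
  "cond_assoc_fun \<sigma> \<phi> \<longleftrightarrow>
     (\<exists>\<alpha> \<beta>. admissible \<alpha> \<beta> \<and>
        (\<forall>\<tau>>0.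
           bdd_above (range (\<lambda>x. norm (\<phi> x) * exp (assoc_fun \<tau> \<sigma> \<alpha> \<bar>x\<bar>))) \<and>
           bdd_above (range (\<lambda>\<xi>. norm (fourier \<phi> \<xi>) * exp (assoc_fun \<tau> \<sigma> \<beta> \<bar>\<xi>\<bar>)))))"

end

theory Submission
  imports Defs "HOL-Probability.Characteristic_Functions" "HOL-Probability.Sinc_Integral"
begin

text \<open>Because \<open>\<sigma> > 1\<close>, factors of size \<open>n ^ (c * n)\<close> and dilations \<open>n \<mapsto> L * n\<close> of the index
  are absorbed into the weights by a change of \<open>\<tau>\<close>; in the Beurling case such a change
  is free. So an interpolation inequality with constants \<open>(2 * (n + 1)) ^ n\<close>, trivial for powers of \<open>x\<close>
  and of Landau--Kolmogorov type for derivatives, fills the gaps of an admissible sequence. The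
  same inequality on rays pointing away from the origin, with a step adapted to \<open>x\<close>, turns separate bounds on
  \<open>x ^ a * f x\<close> and on the derivatives of \<open>f\<close> into mixed ones.

  The Fourier transform turns decay into smoothness and, on the Gelfand--Shilov space, smoothness into decay. Going back
  from the transform to \<open>\<phi>\<close> needs only Fourier inversion for continuous integrable functions with integrable
  transform, which follows by Gaussian regularization.\<close>

section \<open>Weights and gaps\<close>

text \<open>The weight is exp (\<tau> * n powr \<sigma> * ln n), while n ^ (c * n) is exp (c * n *
  ln n). Any excess of \<sigma> over 1 makes the former win, so no interpolation constant has to be
  sharp and a crude argument with finite differences is enough. A half line shapes the
  interpolation: the ray from x away from the origin stays where powers of the variable are at least
  as large as at x, while a full line would pass through the origin and lose the decay of f. The
  danger on the way back from the transform is circularity. Decay of \<open>fourier \<phi>\<close>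
  controls derivatives of \<phi> only once \<phi> is recovered from its transform, at a stage where
  \<phi> is not known to lie in the space. Inversion therefore uses only continuity and the two
  integrability properties, and integrability of the transform is read off from its decay.
  Membership is then reached through separate bounds, which the Fourier transform exchanges.\<close>

lemma weight_ge_1: "\<tau> > 0 \<Longrightarrow> weight \<tau> \<sigma> n \<ge> 1"
  by (auto simp: weight_def intro!: ge_one_powr_ge_zero)

lemma weight_pos: "weight \<tau> \<sigma> n > 0"
  by (auto simp: weight_def)

lemma weight_mult: "weight \<tau> \<sigma> n * weight \<tau>' \<sigma> n = weight (\<tau> + \<tau>') \<sigma> n"
  by (auto simp: weight_def powr_add[symmetric] algebra_simps)

lemma weight_mono:
  assumes "0 < \<tau>" "\<tau> \<le> \<tau>'" "0 < \<sigma>" "m \<le> n"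
  shows "weight \<tau> \<sigma> m \<le> weight \<tau>' \<sigma> n"
proof (cases "m = 0")
  case True
  then show ?thesis using weight_ge_1[of \<tau>' \<sigma> n] assms by (simp add: weight_def)
next
  case False
  have "real m powr (\<tau> * real m powr \<sigma>) \<le> real m powr (\<tau>' * real n powr \<sigma>)"
    using False assms by (intro powr_mono mult_mono powr_mono2) auto
  also have "\<dots> \<le> real n powr (\<tau>' * real n powr \<sigma>)"
    using False assms by (intro powr_mono2) auto
  finally show ?thesis using False assms by (simp add: weight_def)
qed

lemma weight_exp: "n > 0 \<Longrightarrow> weight \<tau> \<sigma> n = exp (\<tau> * real n powr \<sigma> * ln (real n))"
  by (simp add: weight_def powr_def)

text \<open>For a \<ge> 2 the hypothesis gives n \<le> K * a, so n powr \<sigma> * ln n is at most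
  \<kappa> times a powr \<sigma> * ln a, and \<tau>' = \<tau> / \<kappa> pays for it. The indices a
  \<le> 1, where ln a offers nothing to compare with, go into \<open>C\<close>.\<close>

lemma weight_dilate:
  fixes L :: real
  assumes "\<tau> > 0" "\<sigma> > 0" "L \<ge> 1"
  shows "\<exists>\<tau>'>0. \<exists>C>0. \<tau>' \<le> \<tau> \<and>
           (\<forall>a n. real n \<le> L * (real a + 1) \<longrightarrow> weight \<tau>' \<sigma> n \<le> C * weight \<tau> \<sigma> a)"
proof -
  \<comment> \<open>The factor 2 comes from a + 1 \<le> 2 * a. In \<kappa>, the quotient ln K / ln 2
    turns the summand ln K into a multiple of ln a, because ln a \<ge> ln 2.\<close>
  define K where "K = 2 * L"
  define \<kappa> where "\<kappa> = K powr \<sigma> * (1 + ln K / ln 2)"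
  define \<tau>' where "\<tau>' = \<tau> / \<kappa>"
  define C where "C = weight \<tau>' \<sigma> (nat \<lceil>2 * L\<rceil>)"
  have K: "K \<ge> 2" using assms by (simp add: K_def)
  have k1: "\<kappa> \<ge> 1 * 1"
    unfolding \<kappa>_def using K assms by (intro mult_mono ge_one_powr_ge_zero) auto
  have t': "\<tau>' > 0" "\<tau>' \<le> \<tau>" using k1 assms by (auto simp: \<tau>'_def field_simps)
  have C1: "C \<ge> 1" unfolding C_def using t' by (intro weight_ge_1)
  have "weight \<tau>' \<sigma> n \<le> C * weight \<tau> \<sigma> a" if n: "real n \<le> L * (real a + 1)" for a n
  proof (cases "a \<le> 1")
    case True
    have "real n \<le> L * (1 + 1)" using n True assms
      by (smt (verit, best) mult_left_mono of_nat_le_1_iff)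
    then have "real n \<le> 2 * L" by simp
    then have "n \<le> nat \<lceil>2 * L\<rceil>" by linarith
    then have "weight \<tau>' \<sigma> n \<le> C * 1"
      unfolding C_def using t' assms by (simp add: weight_mono)
    also have "\<dots> \<le> C * weight \<tau> \<sigma> a"
      using C1 weight_ge_1[of \<tau> \<sigma> a] assms by (intro mult_left_mono) auto
    finally show ?thesis .
  next
    case False
    show ?thesis
    proof (cases "n = 0")
      case True
      then show ?thesis using C1 weight_ge_1[of \<tau> \<sigma> a] assms mult_mono[of 1 C 1 "weight \<tau> \<sigma> a"]
        by (simp add: weight_def)
    next
      case n0: False
      have "L * (real a + 1) \<le> L * (2 * real a)" using False assms by (intro mult_left_mono) auto
      then have nK: "real n \<le> K * real a" using n by (simp add: K_def)
      have ln2: "ln 2 \<le> ln (real a)" using False by simp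
      have "ln (real n) \<le> ln (K * real a)" using nK n0 K False by simp
      also have "\<dots> = ln K / ln 2 * ln 2 + ln (real a)" using K False by (simp add: ln_mult)
      also have "\<dots> \<le> ln K / ln 2 * ln (real a) + ln (real a)"
        using K ln2 by (intro add_right_mono mult_left_mono) auto
      finally have l: "ln (real n) \<le> (1 + ln K / ln 2) * ln (real a)" by (simp add: algebra_simps)
      have "real n powr \<sigma> \<le> (K * real a) powr \<sigma>" using nK assms by (intro powr_mono2) auto
      also have "\<dots> = K powr \<sigma> * real a powr \<sigma>" using K by (simp add: powr_mult)
      finally have p: "real n powr \<sigma> \<le> K powr \<sigma> * real a powr \<sigma>" .
      have "\<tau>' * (real n powr \<sigma> * ln (real n))
          \<le> \<tau>' * ((K powr \<sigma> * real a powr \<sigma>) * ((1 + ln K / ln 2) * ln (real a)))"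
        using t' n0 p l by (intro mult_left_mono mult_mono) auto
      also have "\<dots> = (\<tau>' * \<kappa>) * (real a powr \<sigma> * ln (real a))" by (simp add: \<kappa>_def)
      also have "\<tau>' * \<kappa> = \<tau>" using k1 by (simp add: \<tau>'_def)
      finally have "weight \<tau>' \<sigma> n \<le> 1 * weight \<tau> \<sigma> a"
        using n0 False by (simp add: weight_exp mult.assoc)
      also have "\<dots> \<le> C * weight \<tau> \<sigma> a"
        using C1 weight_pos[of \<tau> \<sigma> a] by (intro mult_right_mono) auto
      finally show ?thesis .
    qed
  qed
  then show ?thesis using t' C1 by (intro exI[of _ \<tau>'] exI[of _ C] conjI) auto
qed

text \<open>After taking logarithms, n * ln (R * (n + 1)) \<le> c * n * ln n has to be beaten by
  \<tau> * n powr \<sigma> * ln n. This happens once n powr (\<sigma> - 1) \<ge> c / \<tau>, which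
  is where \<sigma> > 1 enters.\<close>

lemma weight_absorb:
  fixes R :: real
  assumes "\<tau> > 0" "\<sigma> > 1" "R \<ge> 1"
  shows "\<exists>C>0. \<forall>n. (R * (real n + 1)) ^ n \<le> C * weight \<tau> \<sigma> n"
proof -
  \<comment> \<open>Chosen so that ln (R * (n + 1)) \<le> c * ln n for n \<ge> 2: the quotient
    handles ln R, and the summand 2 comes from n + 1 \<le> n ^ 2.\<close>
  define c where "c = ln R / ln 2 + 2"
  define N where "N = nat \<lceil>(c / \<tau>) powr (1 / (\<sigma> - 1))\<rceil>"
  have N: "c / \<tau> \<le> real n powr (\<sigma> - 1)" if "n \<ge> N" for n
  proof -
    have "c \<ge> 0" using assms by (simp add: c_def)
    then have "c / \<tau> = ((c / \<tau>) powr (1 / (\<sigma> - 1))) powr (\<sigma> - 1)"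
      using assms by (simp add: powr_powr)
    also have "\<dots> \<le> real n powr (\<sigma> - 1)"
      using assms that unfolding N_def by (intro powr_mono2) (auto simp: nat_ceiling_le_eq)
    finally show ?thesis .
  qed
  \<comment> \<open>The finitely many n \<le> N + 2 are covered by \<open>C\<close>; the + 2
    guarantees n \<ge> 2 for all others.\<close>
  define C where "C = (R * (real (N + 2) + 1)) ^ (N + 2)"
  have C1: "C \<ge> 1" unfolding C_def using assms mult_mono[of 1 R 1 "real (N + 2) + 1"]
    by (intro one_le_power) auto
  have "(R * (real n + 1)) ^ n \<le> C * weight \<tau> \<sigma> n" for n
  proof (cases "n \<le> N + 2")
    case True
    have "(R * (real n + 1)) ^ n \<le> (R * (real (N + 2) + 1)) ^ n"
      using True assms by (intro power_mono mult_left_mono) auto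
    also have "\<dots> \<le> C * 1"
      unfolding C_def mult_1_right using True assms mult_mono[of 1 R 1 "real (N + 2) + 1"]
      by (intro power_increasing) auto
    also have "\<dots> \<le> C * weight \<tau> \<sigma> n"
      using C1 weight_ge_1[of \<tau> \<sigma> n] assms by (intro mult_left_mono) auto
    finally show ?thesis .
  next
    case False
    then have n2: "real n \<ge> 2" by linarith
    have "real n + 1 \<le> real n ^ 2"
      unfolding power2_eq_square using mult_right_mono[of 2 "real n" "real n"] n2 by linarith
    then have "ln (real n + 1) \<le> ln (real n ^ 2)"
      using n2 by (subst ln_le_cancel_iff) auto
    also have "\<dots> = 2 * ln (real n)" using n2 by (simp add: ln_realpow)
    finally have l2: "ln (real n + 1) \<le> 2 * ln (real n)" .
    have "ln R = ln R / ln 2 * ln 2" by simp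
    also have "\<dots> \<le> ln R / ln 2 * ln (real n)"
      using assms n2 by (intro mult_left_mono) auto
    finally have "ln (R * (real n + 1)) \<le> c * ln (real n)"
      using l2 n2 assms by (simp add: ln_mult c_def distrib_right add.commute)
    then have "real n * ln (R * (real n + 1)) \<le> real n * (c * ln (real n))"
      by (intro mult_left_mono) auto
    also have "\<dots> = c * (real n * ln (real n))" by simp
    also have "\<dots> \<le> (\<tau> * real n powr (\<sigma> - 1)) * (real n * ln (real n))"
      using N[of n] False assms n2 by (intro mult_right_mono) (auto simp: field_simps)
    also have "\<dots> = \<tau> * (real n powr (\<sigma> - 1) * real n powr 1) * ln (real n)"
      using n2 by simp
    also have "real n powr (\<sigma> - 1) * real n powr 1 = real n powr \<sigma>"
      by (subst powr_add[symmetric]) simp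
    finally have "exp (real n * ln (R * (real n + 1))) \<le> exp (\<tau> * real n powr \<sigma> * ln (real n))" by simp
    then have "(R * (real n + 1)) ^ n \<le> 1 * weight \<tau> \<sigma> n"
      using n2 assms by (simp add: exp_of_nat_mult weight_exp)
    also have "\<dots> \<le> C * weight \<tau> \<sigma> n"
      using C1 weight_pos[of \<tau> \<sigma> n] by (intro mult_right_mono) auto
    finally show ?thesis .
  qed
  then show ?thesis using C1 by (intro exI[of _ C] conjI) auto
qed

text \<open>Serves two purposes: absorbing the factors (2 * pi) ^ n that arise from differentiating
  a transform, and bounding the set whose supremum is \<open>assoc_fun\<close>.\<close>

lemma weight_absorb_power:
  fixes R :: real
  assumes "\<tau> > 0" "\<sigma> > 1" "R \<ge> 0"
  shows "\<exists>C>0. \<forall>n. R ^ n \<le> C * weight \<tau> \<sigma> n"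
proof -
  obtain C where C: "C > 0" "\<And>n. (max 1 R * (real n + 1)) ^ n \<le> C * weight \<tau> \<sigma> n"
    using weight_absorb[of \<tau> \<sigma> "max 1 R"] assms by auto
  have "R ^ n \<le> (max 1 R * (real n + 1)) ^ n" for n
    using assms mult_mono[of R "max 1 R" 1 "real n + 1"] by (intro power_mono) auto
  then show ?thesis using C order_trans by blast
qed

text \<open>The common form of a Beurling estimate for powers of x and for derivatives:
  \<open>u n x\<close> is the size of the n-th quantity at x. Gap filling is thus proved once for
  both.\<close>

definition weight_bounded :: "real \<Rightarrow> (nat \<Rightarrow> real \<Rightarrow> real) \<Rightarrow> bool" where
  "weight_bounded \<sigma> u \<longleftrightarrow> (\<forall>\<tau>>0. \<exists>C>0. \<forall>n x. u n x \<le> C * weight \<tau> \<sigma> n)"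

abbreviation gap_bounded :: "(nat \<Rightarrow> nat) \<Rightarrow> real \<Rightarrow> bool" where
  "gap_bounded \<alpha> L \<equiv> L > 1 \<and> (\<forall>n\<ge>1. real (\<alpha> (Suc n)) / real (\<alpha> n) \<le> L)"

text \<open>Take the least j with k \<le> \<alpha> j. Its predecessor has value below k, so the
  ratio bound puts \<alpha> j below L * k.\<close>

lemma gap_bounded_next:
  assumes \<alpha>: "strict_mono \<alpha>" "gap_bounded \<alpha> L"
  obtains L' :: real where "L' \<ge> 1" "\<And>k. \<exists>j. k \<le> \<alpha> j \<and> real (\<alpha> j) \<le> L' * (real k + 1)"
proof (rule that)
  \<comment> \<open>The ratio bound starts at n = 1, since admissible sequences have \<alpha> 0 = 0;
    the jump up to \<alpha> 1 has to be covered by the constant itself.\<close>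
  define L' where "L' = max L (real (\<alpha> 1))"
  show "L' \<ge> 1" using \<alpha> unfolding L'_def by linarith
  show "\<exists>j. k \<le> \<alpha> j \<and> real (\<alpha> j) \<le> L' * (real k + 1)" for k
  proof (cases "k \<le> \<alpha> 1")
    case True
    have "real (\<alpha> 1) * 1 \<le> L' * (real k + 1)" using \<alpha> by (intro mult_mono) (auto simp: L'_def)
    then show ?thesis using True by (intro exI[of _ 1]) auto
  next
    case False
    define j where "j = (LEAST j. k \<le> \<alpha> j)"
    have j: "k \<le> \<alpha> j" unfolding j_def using strict_mono_imp_increasing[OF \<alpha>(1), of k] by (rule LeastI)
    have j1: "\<not> j \<le> 1" using j False strict_mono_leD[OF \<alpha>(1), of j 1] by linarith
    then obtain i where i: "j = Suc i" "i \<ge> 1" by (cases j) auto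
    have ki: "\<alpha> i < k" using not_less_Least[of i "\<lambda>j. k \<le> \<alpha> j"] i j_def by auto
    have "\<alpha> i > 0" using strict_monoD[OF \<alpha>(1), of 0 i] i by simp
    then have "real (\<alpha> j) \<le> L * real (\<alpha> i)" using \<alpha> i by (auto simp: field_simps)
    also have "\<dots> \<le> L' * (real k + 1)" using ki \<alpha> by (intro mult_mono) (auto simp: L'_def)
    finally show ?thesis using j by blast
  qed
qed

text \<open>Interpolate order k between order 0 and the next order \<alpha> j of the subsequence.
  The interpolation constant is absorbed into the weight at \<alpha> j, and since \<alpha> j is
  comparable to k, dilation leads back to the weight at k.\<close>

lemma weight_bounded_from_subsequence:
  assumes \<sigma>: "\<sigma> > 1"
    and \<alpha>: "strict_mono \<alpha>" "\<alpha> 0 = 0" "gap_bounded \<alpha> L"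
    and interp: "\<And>A B n k x. (\<And>x. u 0 x \<le> A) \<Longrightarrow> (\<And>x. u n x \<le> B) \<Longrightarrow> k \<le> n \<Longrightarrow>
            u k x \<le> (2 * (real n + 1)) ^ n * (A + B)"
    and sub: "\<And>\<tau>. \<tau> > 0 \<Longrightarrow> \<exists>C>0. \<forall>n x. u (\<alpha> n) x \<le> C * weight \<tau> \<sigma> (\<alpha> n)"
  shows "weight_bounded \<sigma> u"
  unfolding weight_bounded_def
proof (intro allI impI)
  fix \<tau> :: real assume \<tau>: "\<tau> > 0"
  obtain L' where L': "L' \<ge> 1" "\<And>k. \<exists>j. k \<le> \<alpha> j \<and> real (\<alpha> j) \<le> L' * (real k + 1)"
    using gap_bounded_next \<alpha> by blast
  obtain \<tau>' C1 where t: "\<tau>' > 0" "C1 > 0"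
    "\<And>a n. real n \<le> L' * (real a + 1) \<Longrightarrow> weight \<tau>' \<sigma> n \<le> C1 * weight \<tau> \<sigma> a"
    using weight_dilate[OF \<tau>, of \<sigma> L'] \<sigma> L' by auto
  \<comment> \<open>Half of \<tau>' is spent on the interpolation constant and half on the given
    bounds; the two weights multiply to the one for \<tau>'.\<close>
  obtain C2 where C2: "C2 > 0" "\<And>n. (2 * (real n + 1)) ^ n \<le> C2 * weight (\<tau>' / 2) \<sigma> n"
    using weight_absorb[of "\<tau>' / 2" \<sigma> 2] \<sigma> t by auto
  obtain C3 where C3: "C3 > 0" "\<And>n x. u (\<alpha> n) x \<le> C3 * weight (\<tau>' / 2) \<sigma> (\<alpha> n)"
    using sub[of "\<tau>' / 2"] t by auto
  have "u k x \<le> (2 * C2 * C3 * C1) * weight \<tau> \<sigma> k" for k x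
  proof -
    obtain j where j: "k \<le> \<alpha> j" "real (\<alpha> j) \<le> L' * (real k + 1)" using L' by blast
    let ?W = "weight (\<tau>' / 2) \<sigma> (\<alpha> j)"
    have W1: "?W \<ge> 1" using t by (intro weight_ge_1) auto
    \<comment> \<open>The bound at order 0 is part of the subsequence because \<alpha> 0 = 0, and
      its weight is 1.\<close>
    have "u k x \<le> (2 * (real (\<alpha> j) + 1)) ^ \<alpha> j * (C3 + C3 * ?W)"
      using C3(2)[of 0] C3(2)[of j] \<alpha> j by (intro interp) (auto simp: weight_def)
    also have "\<dots> \<le> (C2 * ?W) * (C3 * ?W + C3 * ?W)"
      using C2(2)[of "\<alpha> j"] C3(1) C2(1) W1 by (intro mult_mono add_right_mono) auto
    also have "\<dots> = 2 * C2 * C3 * weight \<tau>' \<sigma> (\<alpha> j)"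
      using weight_mult[of "\<tau>'/2" \<sigma> "\<alpha> j" "\<tau>'/2"] by (simp add: algebra_simps)
    also have "\<dots> \<le> 2 * C2 * C3 * (C1 * weight \<tau> \<sigma> k)"
      using t(3)[OF j(2)] C2 C3 by (intro mult_left_mono) auto
    finally show ?thesis by (simp add: mult.assoc)
  qed
  then show "\<exists>C>0. \<forall>n x. u n x \<le> C * weight \<tau> \<sigma> n"
    using t C2 C3 by (intro exI[of _ "2 * C2 * C3 * C1"]) auto
qed

section \<open>Interpolation between derivatives\<close>

text \<open>A function carried along with all its derivatives. Affine substitution, differencing and
  the Fourier transform act on whole families, so iterated derivatives need not be recomputed;
  \<open>nth_deriv_eq_family\<close> identifies them at the end.\<close>

definition deriv_family :: "(nat \<Rightarrow> real \<Rightarrow> complex) \<Rightarrow> bool" where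
  "deriv_family F \<longleftrightarrow> (\<forall>n x. (F n has_vector_derivative F (Suc n) x) (at x))"

lemma nth_deriv_0 [simp]: "nth_deriv 0 f = f"
  by (simp add: nth_deriv_def)

lemma nth_deriv_Suc: "nth_deriv (Suc n) f = (\<lambda>x. vector_derivative (nth_deriv n f) (at x))"
  by (simp add: nth_deriv_def)

lemma deriv_family_nth_deriv: "smooth f \<Longrightarrow> deriv_family (\<lambda>n. nth_deriv n f)"
  by (auto simp: deriv_family_def smooth_def nth_deriv_Suc vector_derivative_works[symmetric])

lemma nth_deriv_eq_family:
  assumes "deriv_family F"
  shows "nth_deriv n (F 0) = F n"
proof (induction n)
  case (Suc n)
  then show ?case using assms
    by (auto simp: nth_deriv_Suc deriv_family_def intro!: vector_derivative_at)
qed simp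

lemma smooth_family:
  assumes "deriv_family F"
  shows "smooth (F 0)"
  using assms unfolding smooth_def nth_deriv_eq_family[OF assms] deriv_family_def
  by (meson differentiableI_vector)

text \<open>Restriction to the line through x with step c. Here c = 1 gives translates, c = -1 with
  x = 0 the reflection, and a small c the rescaled rays of the mixed estimates.\<close>

lemma deriv_family_affine:
  assumes "deriv_family F"
  shows "deriv_family (\<lambda>n t. of_real c ^ n * F n (x + c * t))"
  unfolding deriv_family_def
proof (intro allI)
  fix n t
  have "(F n has_vector_derivative F (Suc n) (x + c * t)) (at (x + c * t))"
    using assms by (auto simp: deriv_family_def)
  then have "((F n \<circ> (\<lambda>t. x + c * t)) has_vector_derivative c *\<^sub>R F (Suc n) (x + c * t)) (at t)"
    by (intro vector_diff_chain_at) (auto intro!: derivative_eq_intros)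
  then have "((\<lambda>t. of_real c ^ n * F n (x + c * t)) has_vector_derivative
      of_real c ^ n * (c *\<^sub>R F (Suc n) (x + c * t))) (at t)"
    unfolding o_def by (intro has_vector_derivative_mult_right)
  then show "((\<lambda>t. of_real c ^ n * F n (x + c * t)) has_vector_derivative
      of_real c ^ Suc n * F (Suc n) (x + c * t)) (at t)"
    by (simp add: scaleR_conv_of_real mult_ac)
qed

lemma nth_deriv_reflect:
  assumes "smooth f"
  shows "nth_deriv n (\<lambda>x. f (- x)) = (\<lambda>x. (-1) ^ n * nth_deriv n f (- x))"
  using nth_deriv_eq_family[OF deriv_family_affine[OF deriv_family_nth_deriv[OF assms], of "-1" 0]]
  by simp

section \<open>Derivatives against unit differences on the half line\<close>

lemma norm_deriv_family_diff_le:
  assumes F: "deriv_family F" and xy: "x \<ge> 0" "y \<ge> 0" and B: "\<And>t. t \<ge> 0 \<Longrightarrow> norm (F (Suc k) t) \<le> B"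
  shows "norm (F k y - F k x) \<le> B * \<bar>y - x\<bar>"
proof -
  have "norm (F k y - F k x) \<le> B * norm (y - x)"
  proof (rule differentiable_bound[where S = "{0..}" and f' = "\<lambda>t h. h *\<^sub>R F (Suc k) t"])
    show "(F k has_derivative (\<lambda>h. h *\<^sub>R F (Suc k) t)) (at t within {0..})" for t
      using F has_vector_derivative_at_within unfolding deriv_family_def has_vector_derivative_def[symmetric] by blast
    show "onorm (\<lambda>h. h *\<^sub>R F (Suc k) t) \<le> B" if "t \<in> {0..}" for t
    proof (rule onorm_bound)
      show "B \<ge> 0" using order_trans[OF norm_ge_zero B[of t]] that by simp
      show "norm (h *\<^sub>R F (Suc k) t) \<le> B * norm h" for h
        using mult_right_mono[OF B[of t], of "\<bar>h\<bar>"] that by (simp add: mult.commute)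
    qed
  qed (use xy in auto)
  then show ?thesis by simp
qed

lemma norm_forward_difference_le:
  assumes "deriv_family F" "x \<ge> 0" "\<And>t. t \<ge> 0 \<Longrightarrow> norm (F (Suc k) t) \<le> B"
  shows "norm (F k (x + 1) - F k x) \<le> B"
  using norm_deriv_family_diff_le[of F x "x + 1" k B] assms by simp

text \<open>On the unit interval from x the derivative moves by at most B, so the difference over
  that interval misses the derivative at x by at most B.\<close>

lemma norm_forward_difference_linearization_le:
  assumes F: "deriv_family F" and x: "x \<ge> 0" and B: "\<And>t. t \<ge> 0 \<Longrightarrow> norm (F (Suc (Suc k)) t) \<le> B"
  shows "norm (F (Suc k) x - (F k (x + 1) - F k x)) \<le> B"
proof -
  have lin: "norm (F (Suc k) t - F (Suc k) x) \<le> B" if t: "t \<in> {x..x+1}" for t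
  proof -
    have "norm (F (Suc k) t - F (Suc k) x) \<le> B * \<bar>t - x\<bar>"
      using x t by (intro norm_deriv_family_diff_le F B) auto
    also have "\<dots> \<le> B * 1"
      using t B[of 0] order_trans[OF norm_ge_zero B[of 0]] by (intro mult_left_mono) auto
    finally show ?thesis by simp
  qed
  have "norm (F k (x + 1) - F k x - (x + 1 - x) *\<^sub>R F (Suc k) x) \<le> norm (x + 1 - x) * B"
  proof (rule vector_differentiable_bound_linearization[where S = "{x..x+1}"])
    show "(F k has_vector_derivative F (Suc k) t) (at t within {x..x+1})" for t
      using F has_vector_derivative_at_within unfolding deriv_family_def by blast
  qed (use lin in \<open>auto simp: closed_segment_eq_real_ivl\<close>)
  then show ?thesis by (simp add: norm_minus_commute)
qed

abbreviation forward_difference :: "(real \<Rightarrow> complex) \<Rightarrow> real \<Rightarrow> complex" where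
  "forward_difference f \<equiv> (\<lambda>x. f (x + 1) - f x)"

lemma deriv_family_difference:
  assumes "deriv_family F"
  shows "deriv_family (\<lambda>n. forward_difference (F n))"
proof -
  have "(forward_difference (F n) has_vector_derivative forward_difference (F (Suc n)) x) (at x)" for n x
  proof (rule has_vector_derivative_diff)
    have "((\<lambda>t. of_real 1 ^ n * F n (1 + 1 * t)) has_vector_derivative of_real 1 ^ Suc n * F (Suc n) (1 + 1 * x)) (at x)"
      using deriv_family_affine[OF assms, of 1 1] unfolding deriv_family_def by blast
    then show "((\<lambda>x. F n (x + 1)) has_vector_derivative F (Suc n) (x + 1)) (at x)"
      by (simp add: add.commute)
  qed (use assms in \<open>auto simp: deriv_family_def\<close>)
  then show ?thesis by (simp add: deriv_family_def)
qed

lemma norm_iterated_difference_le: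
  assumes "\<And>t. t \<ge> 0 \<Longrightarrow> norm (f t) \<le> A" "x \<ge> 0"
  shows "norm ((forward_difference ^^ k) f x) \<le> 2 ^ k * A"
  using assms(2)
proof (induction k arbitrary: x)
  case (Suc k)
  have "norm ((forward_difference ^^ k) f (x + 1)) \<le> 2 ^ k * A" "norm ((forward_difference ^^ k) f x) \<le> 2 ^ k * A"
    using Suc.prems by (auto intro: Suc.IH)
  then have "norm ((forward_difference ^^ Suc k) f x) \<le> 2 ^ k * A + 2 ^ k * A"
    unfolding funpow.simps o_apply
    by (rule order_trans[OF norm_triangle_ineq4 add_mono])
  then show ?case by (simp add: mult.commute mult.left_commute)
qed (use assms in simp)

text \<open>Trade one derivative for one difference at cost B and repeat with the differenced
  family: a unit difference of the derivative of order k + 1 is bounded by the derivative of order k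
  + 2, so the same B serves throughout and k trades cost k * B.\<close>

lemma norm_deriv_minus_iterated_difference_le:
  assumes "deriv_family F" "x \<ge> 0" "\<And>t. t \<ge> 0 \<Longrightarrow> norm (F (Suc k) t) \<le> B"
  shows "norm (F k x - (forward_difference ^^ k) (F 0) x) \<le> real k * B"
  using assms
proof (induction k arbitrary: F x)
  case (Suc k)
  let ?G = "\<lambda>n. forward_difference (F n)"
  have "norm (?G (Suc k) t) \<le> B" if "t \<ge> 0" for t
    using Suc.prems that by (intro norm_forward_difference_le) auto
  then have 1: "norm (?G k x - (forward_difference ^^ k) (?G 0) x) \<le> real k * B"
    using Suc.prems by (intro Suc.IH[of ?G] deriv_family_difference) auto
  have 2: "norm (F (Suc k) x - ?G k x) \<le> B"
    using Suc.prems by (intro norm_forward_difference_linearization_le) auto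
  have "norm ((F (Suc k) x - ?G k x) + (?G k x - (forward_difference ^^ k) (?G 0) x)) \<le> B + real k * B"
    using 1 2 by (rule norm_triangle_mono[rotated])
  then show ?case by (simp add: funpow_Suc_right algebra_simps del: funpow.simps)
qed auto

text \<open>On every unit step the \<open>k\<close>-th derivative differs from the \<open>k\<close>-th difference of \<open>F 0\<close> by
  at most \<open>k\<close> times the supremum of the next derivative; this bounds the derivatives one after
  the other from order \<open>n\<close> downwards.\<close>

lemma landau_kolmogorov_half_line:
  assumes F: "deriv_family F"
    and A: "\<And>t. t \<ge> 0 \<Longrightarrow> norm (F 0 t) \<le> A" and B: "\<And>t. t \<ge> 0 \<Longrightarrow> norm (F n t) \<le> B"
    and k: "k \<le> n" and t: "t \<ge> 0"
  shows "norm (F k t) \<le> (2 * (real n + 1)) ^ n * (A + B)"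
proof -
  have A0: "A \<ge> 0" and B0: "B \<ge> 0" using order_trans[OF norm_ge_zero] A[of 0] B[of 0] by auto
  \<comment> \<open>Each step down costs a factor n + 1: with Q the bound one order higher, the
    estimate is k * Q + 2 ^ k * A, and the factor 2 ^ n is kept in Q so that 2 ^ k * A \<le>
    Q.\<close>
  have "norm (F k t) \<le> 2 ^ n * (real n + 1) ^ (n - k) * (A + B)" if "t \<ge> 0" for t
    using k that
  proof (induction k arbitrary: t rule: inc_induct)
    case base
    have "norm (F n t) \<le> 1 * (A + B)" using B[OF base] A0 by simp
    also have "\<dots> \<le> 2 ^ n * (A + B)" using A0 B0 by (intro mult_right_mono) auto
    finally show ?case by simp
  next
    case (step k)
    define Q where "Q = 2 ^ n * (real n + 1) ^ (n - Suc k) * (A + B)"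
    have Q: "2 ^ k * A \<le> Q"
    proof -
      have "2 ^ k * 1 * A \<le> 2 ^ n * (real n + 1) ^ (n - Suc k) * (A + B)"
        using step.hyps A0 B0 by (intro mult_mono) auto
      then show ?thesis by (simp add: Q_def)
    qed
    have "norm (F k t - (forward_difference ^^ k) (F 0) t) \<le> real k * Q"
      unfolding Q_def using step by (intro norm_deriv_minus_iterated_difference_le F) auto
    moreover have "norm ((forward_difference ^^ k) (F 0) t) \<le> 2 ^ k * A"
      using A step.prems by (intro norm_iterated_difference_le)
    ultimately have "norm ((F k t - (forward_difference ^^ k) (F 0) t) + (forward_difference ^^ k) (F 0) t)
        \<le> real k * Q + 2 ^ k * A"
      by (rule norm_triangle_mono)
    also have "\<dots> \<le> real n * Q + Q"
      using Q step.hyps A0 B0 by (intro add_mono mult_right_mono) (auto simp: Q_def)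
    also have "\<dots> = 2 ^ n * (real n + 1) ^ Suc (n - Suc k) * (A + B)"
      by (simp add: Q_def algebra_simps)
    also have "Suc (n - Suc k) = n - k" using step.hyps by simp
    finally show ?case by simp
  qed
  from this[OF t] have "norm (F k t) \<le> 2 ^ n * (real n + 1) ^ (n - k) * (A + B)" .
  also have "\<dots> \<le> 2 ^ n * (real n + 1) ^ n * (A + B)"
    using A0 B0 by (intro mult_right_mono mult_left_mono power_increasing) auto
  finally show ?thesis by (simp only: power_mult_distrib)
qed

section \<open>Membership in the Gelfand--Shilov space\<close>

abbreviation decays :: "real \<Rightarrow> (real \<Rightarrow> complex) \<Rightarrow> bool" where
  "decays \<sigma> f \<equiv> weight_bounded \<sigma> (\<lambda>n x. norm (of_real (x ^ n) * f x))"

abbreviation derivs_bounded :: "real \<Rightarrow> (real \<Rightarrow> complex) \<Rightarrow> bool" where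
  "derivs_bounded \<sigma> f \<equiv> weight_bounded \<sigma> (\<lambda>n x. norm (nth_deriv n f x))"

lemma decays_from_subsequence:
  assumes "\<sigma> > 1" "strict_mono \<alpha>" "\<alpha> 0 = 0" "gap_bounded \<alpha> L"
    and "\<And>\<tau>. \<tau> > 0 \<Longrightarrow> \<exists>C>0. \<forall>n x. norm (of_real (x ^ \<alpha> n) * f x) \<le> C * weight \<tau> \<sigma> (\<alpha> n)"
  shows "decays \<sigma> f"
proof (rule weight_bounded_from_subsequence[OF assms(1-4) _ assms(5)])
  fix A B :: real and n k :: nat and x :: real
  assume A: "\<And>x. norm (of_real (x ^ 0) * f x) \<le> A"
    and B: "\<And>x. norm (of_real (x ^ n) * f x) \<le> B" and k: "k \<le> n"
  have AB: "A \<ge> 0" "B \<ge> 0" using order_trans[OF norm_ge_zero] A[of 0] B[of 0] by auto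
  \<comment> \<open>This already interpolates with constant 1; the larger constant is inserted only
    to match the common form.\<close>
  have "\<bar>x\<bar> ^ k \<le> 1 + \<bar>x\<bar> ^ n"
  proof (cases "\<bar>x\<bar> \<le> 1")
    case True
    then show ?thesis using power_le_one[of "\<bar>x\<bar>" k] by (simp add: add_increasing2)
  next
    case False
    then have "\<bar>x\<bar> ^ k \<le> \<bar>x\<bar> ^ n" using k by (intro power_increasing) auto
    then show ?thesis by simp
  qed
  then have "\<bar>x\<bar> ^ k * norm (f x) \<le> (1 + \<bar>x\<bar> ^ n) * norm (f x)"
    by (rule mult_right_mono) simp
  also have "\<dots> \<le> A + B"
    using A[of x] B[of x] by (simp add: norm_mult norm_power power_abs[symmetric] algebra_simps)
  also have "\<dots> \<le> (2 * (real n + 1)) ^ n * (A + B)"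
    using AB mult_right_mono[of 1 "(2 * (real n + 1)) ^ n" "A + B"] by simp
  finally show "norm (of_real (x ^ k) * f x) \<le> (2 * (real n + 1)) ^ n * (A + B)"
    by (simp add: norm_mult norm_power power_abs)
qed

text \<open>The half-line inequality is applied to the translate t \<mapsto> f (x + t) and evaluated
  at t = 0.\<close>

lemma derivs_bounded_from_subsequence:
  assumes "\<sigma> > 1" "strict_mono \<alpha>" "\<alpha> 0 = 0" "gap_bounded \<alpha> L" "smooth f"
    and "\<And>\<tau>. \<tau> > 0 \<Longrightarrow> \<exists>C>0. \<forall>n x. norm (nth_deriv (\<alpha> n) f x) \<le> C * weight \<tau> \<sigma> (\<alpha> n)"
  shows "derivs_bounded \<sigma> f"
proof (rule weight_bounded_from_subsequence[OF assms(1-4) _ assms(6)])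
  fix A B :: real and n k :: nat and x :: real
  assume A: "\<And>x. norm (nth_deriv 0 f x) \<le> A" and B: "\<And>x. norm (nth_deriv n f x) \<le> B" and k: "k \<le> n"
  show "norm (nth_deriv k f x) \<le> (2 * (real n + 1)) ^ n * (A + B)"
    using landau_kolmogorov_half_line[OF deriv_family_affine[OF deriv_family_nth_deriv[OF assms(5)], of 1 x], of A n B k 0]
      A B k by simp
qed

text \<open>Outside the unit ball, interpolate between \<open>f\<close> and its derivative of order \<open>2 b\<close> on the ray
  from \<open>x\<close> away from the origin, with step \<open>\<bar>x\<bar> powr (- a / b)\<close>. On that ray \<open>f\<close> is of
  size \<open>\<bar>x\<bar> ^ (- 2 * a)\<close>, so that both terms of the interpolation inequality carry the same power of \<open>x\<close>.\<close>

lemma gelfand_shilovI: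
  assumes \<sigma>: "\<sigma> > 1" and f: "smooth f" "decays \<sigma> f" "derivs_bounded \<sigma> f"
  shows "f \<in> gelfand_shilov \<sigma>"
  unfolding gelfand_shilov_def
proof (intro CollectI conjI allI impI)
  show "smooth f" by fact
  fix \<tau> :: real assume \<tau>: "\<tau> > 0"
  obtain \<tau>' C1 where t: "\<tau>' > 0" "C1 > 0" "\<tau>' \<le> \<tau>"
    "\<And>a n. real n \<le> 2 * (real a + 1) \<Longrightarrow> weight \<tau>' \<sigma> n \<le> C1 * weight \<tau> \<sigma> a"
    using weight_dilate[OF \<tau>, of \<sigma> 2] \<sigma> by auto
  \<comment> \<open>Two weights at index 2 * b will occur, one from the interpolation constant and
    one from the data; with parameter s they multiply to the weight for \<tau>', which dilation
    brings back to index b.\<close>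
  define s where "s = \<tau>' / 2"
  have s: "s > 0" "s \<le> \<tau>" "s \<le> \<tau>'" using t by (auto simp: s_def)
  obtain C2 where C2: "C2 > 0" "\<And>n. (2 * (real n + 1)) ^ n \<le> C2 * weight s \<sigma> n"
    using weight_absorb[OF s(1) \<sigma>, of 2] by auto
  obtain C3 where C3: "C3 > 0" "\<And>n x. norm (of_real (x ^ n) * f x) \<le> C3 * weight s \<sigma> n"
    using f(2) s unfolding weight_bounded_def by blast
  obtain C4 where C4: "C4 > 0" "\<And>n x. norm (nth_deriv n f x) \<le> C4 * weight s \<sigma> n"
    using f(3) s unfolding weight_bounded_def by blast
  define C where "C = C3 + C4 + C2 * (C3 + C4) * C1 * C1"
  have Cge: "C3 \<le> C" "C4 \<le> C" "C2 * (C3 + C4) * C1 * C1 \<le> C"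
    using C2 C3 C4 t by (auto simp: C_def)
  have mono: "weight s \<sigma> n \<le> weight \<tau> \<sigma> n" for n using s \<sigma> by (intro weight_mono) auto
  have ge1: "weight \<tau> \<sigma> n \<ge> 1" for n using \<tau> by (rule weight_ge_1)
  have "norm (of_real (x ^ a) * nth_deriv b f x) \<le> C * weight \<tau> \<sigma> a * weight \<tau> \<sigma> b" for a b x
  proof -
    \<comment> \<open>The exponent - a / b of the step excludes b = 0; for \<bar>x\<bar> \<le> 1 the
      factor x ^ a can simply be dropped.\<close>
    consider "b = 0" | "\<bar>x\<bar> \<le> 1" | "b > 0" "\<bar>x\<bar> > 1" by linarith
    then show ?thesis
    proof cases
      case 1
      have "norm (of_real (x ^ a) * f x) \<le> C3 * weight s \<sigma> a" by (rule C3)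
      also have "\<dots> \<le> C * weight \<tau> \<sigma> a"
        using Cge C3 mono by (intro mult_mono) (auto intro: less_imp_le[OF weight_pos])
      finally show ?thesis using 1 by (simp add: weight_def[of _ _ 0])
    next
      case 2
      have "norm (of_real (x ^ a) * nth_deriv b f x) \<le> 1 * (C4 * weight s \<sigma> b)"
        unfolding norm_mult using 2 C4
        by (intro mult_mono) (auto simp: norm_power power_le_one)
      also have "\<dots> \<le> C * weight \<tau> \<sigma> b"
        using Cge C4 mono by (auto intro!: mult_mono intro: less_imp_le[OF weight_pos])
      also have "\<dots> \<le> C * weight \<tau> \<sigma> a * weight \<tau> \<sigma> b"
        using ge1[of a] ge1[of b] Cge C3 by (intro mult_right_mono) (auto simp: mult_le_cancel_left1)
      finally show ?thesis .
    next
      case 3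
      define R where "R = (2 * (real (2 * b) + 1)) ^ (2 * b)"
      define h where "h = \<bar>x\<bar> powr (- real a / real b)"
      define c where "c = sgn x * h"
      define y where "y = \<bar>x\<bar> ^ a"
      have y: "y > 0" using 3 by (simp add: y_def)
      have y2: "y ^ 2 = \<bar>x\<bar> ^ (2 * a)" by (simp add: y_def power_mult[symmetric] mult.commute)
      have h0: "h > 0" using 3 by (simp add: h_def)
      have "h ^ b = \<bar>x\<bar> powr (- real a / real b * real b)"
        using h0 by (simp only: powr_realpow[symmetric] h_def powr_powr)
      also have "- real a / real b * real b = - real a" using 3 by simp
      finally have hb: "h ^ b = 1 / y"
        using 3 by (simp add: y_def powr_minus_divide powr_realpow)
      have absc: "\<bar>c\<bar> = h" using 3 h0 by (auto simp: c_def abs_mult)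
      have ray: "\<bar>x\<bar> \<le> \<bar>x + c * t\<bar>" if "t \<ge> 0" for t
      proof -
        have ht: "0 \<le> h * t" using that h0 by simp
        have "x + c * t = sgn x * (\<bar>x\<bar> + h * t)"
          by (simp add: c_def algebra_simps abs_mult_sgn)
        then have "\<bar>x + c * t\<bar> = \<bar>x\<bar> + h * t"
          using 3 ht by (simp add: abs_mult)
        then show ?thesis using ht by linarith
      qed
      have "norm (of_real c ^ b * nth_deriv b f (x + c * 0))
        \<le> R * (C3 * weight s \<sigma> (2 * a) / y ^ 2 + C4 * weight s \<sigma> (2 * b) / y ^ 2)"
        unfolding R_def
      proof (rule landau_kolmogorov_half_line[OF deriv_family_affine[OF deriv_family_nth_deriv[OF f(1)]]])
        fix t :: real assume t: "t \<ge> 0"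
        have "y ^ 2 * norm (f (x + c * t)) \<le> \<bar>x + c * t\<bar> ^ (2 * a) * norm (f (x + c * t))"
          unfolding y2 using ray[OF t] by (intro mult_right_mono power_mono) auto
        also have "\<dots> \<le> C3 * weight s \<sigma> (2 * a)"
          using C3(2)[of "x + c * t" "2 * a"] by (simp only: norm_mult norm_of_real power_abs)
        finally show "norm (of_real c ^ 0 * nth_deriv 0 f (x + c * t)) \<le> C3 * weight s \<sigma> (2 * a) / y ^ 2"
          using y by (simp add: field_simps)
        have "norm (of_real c ^ (2 * b) * nth_deriv (2 * b) f (x + c * t))
            = (h ^ b) ^ 2 * norm (nth_deriv (2 * b) f (x + c * t))"
          by (simp add: norm_mult norm_power absc power_mult[symmetric] mult.commute)
        also have "\<dots> \<le> (h ^ b) ^ 2 * (C4 * weight s \<sigma> (2 * b))"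
          using C4 by (intro mult_left_mono) auto
        finally show "norm (of_real c ^ (2 * b) * nth_deriv (2 * b) f (x + c * t)) \<le> C4 * weight s \<sigma> (2 * b) / y ^ 2"
          by (simp add: hb power_divide)
      qed auto
      \<comment> \<open>Both weights are at least 1, so each summand is dominated by the product,
        which has the shape required of a mixed bound.\<close>
      moreover have prod_ge: "weight s \<sigma> (2 * a) \<le> weight s \<sigma> (2 * a) * weight s \<sigma> (2 * b)"
        "weight s \<sigma> (2 * b) \<le> weight s \<sigma> (2 * a) * weight s \<sigma> (2 * b)"
        using mult_left_mono[OF weight_ge_1[OF s(1)] less_imp_le[OF weight_pos]]
          mult_right_mono[OF weight_ge_1[OF s(1)] less_imp_le[OF weight_pos]] by fastforce+
      \<comment> \<open>The left side carries h ^ b = 1 / y and the right side y ^ (-2); clearing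
        denominators leaves exactly the wanted factor y = \<bar>x\<bar> ^ a.\<close>
      ultimately have "norm (nth_deriv b f x) / y
        \<le> R * (C3 * weight s \<sigma> (2 * a) + C4 * weight s \<sigma> (2 * b)) / y ^ 2"
        by (simp add: norm_mult norm_power absc hb add_divide_distrib distrib_left)
      then have "norm (nth_deriv b f x) * y
        \<le> R * (C3 * weight s \<sigma> (2 * a) + C4 * weight s \<sigma> (2 * b))"
        using y by (simp add: field_simps power2_eq_square)
      also have "\<dots> \<le> (C2 * weight s \<sigma> (2 * b)) *
          (C3 * (weight s \<sigma> (2 * a) * weight s \<sigma> (2 * b)) + C4 * (weight s \<sigma> (2 * a) * weight s \<sigma> (2 * b)))"
        using C2(2)[of "2 * b", folded R_def] C2(1) C3(1) C4(1) less_imp_le[OF weight_pos[of s \<sigma>]]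
        by (intro mult_mono add_mono prod_ge) (auto intro!: add_nonneg_nonneg)
      also have "\<dots> = C2 * (C3 + C4) * weight s \<sigma> (2 * a) * (weight s \<sigma> (2 * b) * weight s \<sigma> (2 * b))"
        by (simp add: algebra_simps)
      also have "weight s \<sigma> (2 * b) * weight s \<sigma> (2 * b) = weight \<tau>' \<sigma> (2 * b)"
        by (simp add: weight_mult s_def)
      also have "C2 * (C3 + C4) * weight s \<sigma> (2 * a) * weight \<tau>' \<sigma> (2 * b)
          \<le> C2 * (C3 + C4) * (C1 * weight \<tau> \<sigma> a) * (C1 * weight \<tau> \<sigma> b)"
        using t(2) t(4)[of "2 * a" a] t(4)[of "2 * b" b] C2(1) C3(1) C4(1) s \<sigma>
          less_imp_le[OF weight_pos] order_trans[OF weight_mono[of s \<tau>' \<sigma> "2 * a" "2 * a"]]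
        by (intro mult_mono mult_nonneg_nonneg) auto
      also have "\<dots> = (C2 * (C3 + C4) * C1 * C1) * (weight \<tau> \<sigma> a * weight \<tau> \<sigma> b)" by simp
      also have "\<dots> \<le> C * (weight \<tau> \<sigma> a * weight \<tau> \<sigma> b)"
        using Cge less_imp_le[OF weight_pos] by (intro mult_right_mono) auto
      finally show ?thesis by (simp add: norm_mult norm_power y_def power_abs mult_ac)
    qed
  qed
  moreover have "C > 0" using Cge C3 by linarith
  ultimately show "\<exists>C>0. \<forall>a b x. norm (of_real (x ^ a) * nth_deriv b f x) \<le> C * weight \<tau> \<sigma> a * weight \<tau> \<sigma> b"
    by blast
qed

lemma gelfand_shilovD:
  assumes "f \<in> gelfand_shilov \<sigma>"
  shows "smooth f" "decays \<sigma> f" "derivs_bounded \<sigma> f"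
proof -
  show "smooth f" using assms by (simp add: gelfand_shilov_def)
  have *: "\<exists>C>0. \<forall>a b x. norm (of_real (x ^ a) * nth_deriv b f x) \<le> C * weight \<tau> \<sigma> a * weight \<tau> \<sigma> b"
    if "\<tau> > 0" for \<tau> using assms that by (simp add: gelfand_shilov_def)
  show "decays \<sigma> f" unfolding weight_bounded_def
  proof (intro allI impI)
    fix \<tau> :: real assume "\<tau> > 0"
    then obtain C where C: "C > 0" "\<And>a b x. norm (of_real (x ^ a) * nth_deriv b f x) \<le> C * weight \<tau> \<sigma> a * weight \<tau> \<sigma> b"
      using * by blast
    then show "\<exists>C>0. \<forall>n x. norm (of_real (x ^ n) * f x) \<le> C * weight \<tau> \<sigma> n"
      using C(2)[of _ _ 0] by (auto simp: weight_def[of _ _ 0] intro!: exI[of _ C])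
  qed
  show "derivs_bounded \<sigma> f" unfolding weight_bounded_def
  proof (intro allI impI)
    fix \<tau> :: real assume "\<tau> > 0"
    then obtain C where C: "C > 0" "\<And>a b x. norm (of_real (x ^ a) * nth_deriv b f x) \<le> C * weight \<tau> \<sigma> a * weight \<tau> \<sigma> b"
      using * by blast
    then show "\<exists>C>0. \<forall>n x. norm (nth_deriv n f x) \<le> C * weight \<tau> \<sigma> n"
      using C(2)[of _ 0] by (auto simp: weight_def[of _ _ 0] intro!: exI[of _ C])
  qed
qed

section \<open>Fourier transforms of decaying functions\<close>

abbreviation wave :: "real \<Rightarrow> real \<Rightarrow> complex" where
  "wave x \<xi> \<equiv> exp (- (2 * of_real pi * \<i> * of_real x * of_real \<xi>))"

lemma norm_wave [simp]: "norm (wave x \<xi>) = 1"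
  by (simp add: norm_exp_eq_Re)

lemma wave_eq_iexp: "wave x \<xi> = iexp (- (2 * pi * x * \<xi>))"
  by (simp add: algebra_simps)

lemma wave_measurable [measurable]: "(\<lambda>x. wave x \<xi>) \<in> borel_measurable borel"
  by (intro borel_measurable_continuous_onI continuous_intros)

lemma integrable_times_wave:
  assumes "integrable lborel f"
  shows "integrable lborel (\<lambda>x. f x * wave x \<xi>)"
proof (rule Bochner_Integration.integrable_bound[OF assms])
  show "(\<lambda>x. f x * wave x \<xi>) \<in> borel_measurable lborel"
    using borel_measurable_integrable[OF assms] by measurable
qed (simp add: norm_mult)

lemma norm_fourier_le:
  assumes "integrable lborel f"
  shows "norm (fourier f \<xi>) \<le> (LINT x|lborel. norm (f x))"
  unfolding fourier_def
  using integral_norm_bound[of lborel "\<lambda>x. f x * wave x \<xi>"] by (simp add: norm_mult)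

text \<open>With s = - 2 * pi * x * h, the remainder of iexp s after its linear part is at most s ^
  2 / 2. A finite second moment hence bounds the error of the linear approximation by h ^ 2 * M, and
  no limit under the integral is taken.\<close>

lemma has_vector_derivative_fourier:
  assumes f: "integrable lborel f" "integrable lborel (\<lambda>x. of_real x * f x)"
    "integrable lborel (\<lambda>x. of_real x ^ 2 * f x)"
  shows "(fourier f has_vector_derivative fourier (\<lambda>x. - (2 * of_real pi * \<i> * of_real x) * f x) \<xi>) (at \<xi>)"
proof -
  let ?g = "\<lambda>x. - (2 * of_real pi * \<i> * of_real x) * f x"
  define M where "M = (LINT x|lborel. 2 * pi ^ 2 * norm (of_real x ^ 2 * f x))"
  have g: "integrable lborel ?g"
    using integrable_mult_right[OF f(2), of "- (2 * of_real pi * \<i>)"] by (simp add: mult_ac)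
  have bound: "norm (fourier f (\<xi> + h) - fourier f \<xi> - h *\<^sub>R fourier ?g \<xi>) \<le> h ^ 2 * M" for h
  proof -
    let ?r = "\<lambda>x. f x * wave x (\<xi> + h) - f x * wave x \<xi> - h *\<^sub>R (?g x * wave x \<xi>)"
    note i1 = integrable_times_wave[OF f(1), of "\<xi> + h"]
      and i2 = integrable_times_wave[OF f(1), of \<xi>]
      and i3 = integrable_scaleR_right[OF integrable_times_wave[OF g, of \<xi>], of h]
    have "(LINT x|lborel. ?r x) = fourier f (\<xi> + h) - fourier f \<xi> - h *\<^sub>R fourier ?g \<xi>"
      unfolding fourier_def Bochner_Integration.integral_diff[OF Bochner_Integration.integrable_diff[OF i1 i2] i3]
        Bochner_Integration.integral_diff[OF i1 i2] integral_scaleR_right by (rule refl)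
    then have "norm (fourier f (\<xi> + h) - fourier f \<xi> - h *\<^sub>R fourier ?g \<xi>) = norm (LINT x|lborel. ?r x)"
      by (simp only:)
    also have "\<dots> \<le> (LINT x|lborel. norm (?r x))" by (rule integral_norm_bound[of lborel ?r])
    also have "\<dots> \<le> (LINT x|lborel. h ^ 2 * (2 * pi ^ 2 * norm (of_real x ^ 2 * f x)))"
    proof (rule integral_mono)
      show "integrable lborel (\<lambda>x. norm (?r x))"
        by (intro integrable_norm Bochner_Integration.integrable_diff[OF Bochner_Integration.integrable_diff[OF i1 i2] i3])
      show "integrable lborel (\<lambda>x. h ^ 2 * (2 * pi ^ 2 * norm (of_real x ^ 2 * f x)))"
        using f(3) by simp
      fix x :: real
      define s where "s = - (2 * pi * x * h)"
      have shift: "wave x (\<xi> + h) = wave x \<xi> * iexp s"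
        unfolding s_def exp_add[symmetric] of_real_add of_real_minus of_real_mult of_real_numeral
        by (rule arg_cong[of _ _ exp]) (simp add: algebra_simps)
      have sum1: "(\<Sum>k\<le>1. (\<i> * of_real s) ^ k / fact k) = 1 + \<i> * of_real s" by simp
      have lin: "h *\<^sub>R (?g x * wave x \<xi>) = f x * wave x \<xi> * (\<i> * of_real s)"
        unfolding s_def scaleR_conv_of_real of_real_minus of_real_mult of_real_numeral
        by (simp only: mult_minus_left mult_minus_right mult_ac)
      have "?r x = f x * wave x \<xi> * (iexp s - (\<Sum>k\<le>1. (\<i> * s) ^ k / fact k))"
        unfolding shift sum1 lin by (simp only: right_diff_distrib distrib_left mult_1_right mult.assoc diff_diff_eq)
      then have "norm (?r x) = norm (f x) * norm (iexp s - (\<Sum>k\<le>1. (\<i> * s) ^ k / fact k))"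
        by (simp only: norm_mult norm_wave mult_1_right)
      also have "\<dots> \<le> norm (f x) * (\<bar>s\<bar> ^ Suc 1 / fact (Suc 1))"
        by (intro mult_left_mono iexp_approx1) simp
      also have "\<dots> = h ^ 2 * (2 * pi ^ 2 * norm (of_real x ^ 2 * f x))"
        by (simp add: s_def norm_mult norm_power abs_mult power2_eq_square)
      finally show "norm (?r x) \<le> h ^ 2 * (2 * pi ^ 2 * norm (of_real x ^ 2 * f x))" .
    qed
    finally show ?thesis by (simp add: M_def)
  qed
  have "((\<lambda>h. norm (fourier f (\<xi> + h) - fourier f \<xi> - h *\<^sub>R fourier ?g \<xi>) / norm h) \<longlongrightarrow> 0) (at 0)"
  proof (rule Lim_null_comparison)
    show "eventually (\<lambda>h. norm (norm (fourier f (\<xi> + h) - fourier f \<xi> - h *\<^sub>R fourier ?g \<xi>) / norm h)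
        \<le> \<bar>h\<bar> * M) (at 0)"
    proof (intro always_eventually allI)
      fix h
      have "norm (fourier f (\<xi> + h) - fourier f \<xi> - h *\<^sub>R fourier ?g \<xi>) / \<bar>h\<bar> \<le> h ^ 2 * M / \<bar>h\<bar>"
        using bound by (rule divide_right_mono) simp
      also have "\<dots> = \<bar>h\<bar> * M"
        by (cases "h = 0") (auto simp: power2_eq_square abs_if)
      finally show "norm (norm (fourier f (\<xi> + h) - fourier f \<xi> - h *\<^sub>R fourier ?g \<xi>) / norm h) \<le> \<bar>h\<bar> * M"
        by simp
    qed
    show "((\<lambda>h. \<bar>h\<bar> * M) \<longlongrightarrow> 0) (at 0)" by (auto intro!: tendsto_eq_intros)
  qed
  then show ?thesis
    unfolding has_vector_derivative_def has_derivative_at by (simp add: bounded_linear_scaleR_left)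
qed

lemma scaled_power_times:
  fixes c y z :: complex
  shows "(- (c * z)) ^ n * y = (- c) ^ n * (z ^ n * y)"
  by (simp only: mult_minus_left[symmetric] power_mult_distrib mult.assoc)

lemma deriv_family_fourier:
  assumes "\<And>n. integrable lborel (\<lambda>x. of_real x ^ n * f x)"
  shows "deriv_family (\<lambda>n. fourier (\<lambda>x. (- (2 * of_real pi * \<i> * of_real x)) ^ n * f x))"
proof -
  let ?g = "\<lambda>n x. (- (2 * of_real pi * \<i> * of_real x)) ^ n * f x"
  have *: "integrable lborel (\<lambda>x. of_real x ^ k * ?g n x)" for n k
  proof -
    have eq: "of_real x ^ k * ?g n x = (- (2 * of_real pi * \<i>)) ^ n * (of_real x ^ (k + n) * f x)" for x
      unfolding scaled_power_times[of "2 * of_real pi * \<i>" "of_real x"] power_add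
      by (simp only: mult_ac)
    show ?thesis unfolding eq by (rule integrable_mult_right) (rule assms)
  qed
  have "(fourier (?g n) has_vector_derivative fourier (?g (Suc n)) \<xi>) (at \<xi>)" for n \<xi>
  proof -
    have eq: "?g (Suc n) = (\<lambda>x. - (2 * of_real pi * \<i> * of_real x) * ?g n x)"
      by (simp only: power_Suc mult.assoc)
    show ?thesis
      unfolding eq using *[where n=n and k=0] *[where n=n and k=1] *[where n=n and k=2]
      by (intro has_vector_derivative_fourier) (simp_all only: power_0 mult_1 power_one_right)
  qed
  then show ?thesis unfolding deriv_family_def by blast
qed

section \<open>Integrals controlled by pointwise decay\<close>

lemma integrable_inverse_1_plus_square_real: "integrable lborel (\<lambda>x::real. inverse (1 + x ^ 2))"
  using integrable_inverse_1_plus_square by (simp add: set_integrable_def)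

lemma integral_inverse_1_plus_square_real: "(LINT x|lborel. inverse (1 + x ^ 2)) = pi"
  using LBINT_inverse_1_plus_square
  by (simp add: interval_lebesgue_integral_def set_lebesgue_integral_def)

text \<open>Compare with (P + Q) / (1 + x ^ 2), whose integral is pi * (P + Q). The explicit value
  is kept because it bounds the supremum of a transform in terms of pointwise bounds.\<close>

lemma integrable_of_bounds:
  fixes g :: "real \<Rightarrow> complex"
  assumes [measurable]: "g \<in> borel_measurable borel"
    and P: "\<And>x. norm (g x) \<le> P" and Q: "\<And>x. x ^ 2 * norm (g x) \<le> Q"
  shows "integrable lborel g" "(LINT x|lborel. norm (g x)) \<le> pi * (P + Q)"
proof -
  have le: "norm (g x) \<le> (P + Q) * inverse (1 + x ^ 2)" for x
  proof -
    have "norm (g x) * (1 + x ^ 2) \<le> P + Q" using P[of x] Q[of x] by (simp add: algebra_simps)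
    then show ?thesis
      by (simp add: pos_le_divide_eq add_pos_nonneg divide_inverse[symmetric])
  qed
  have int: "integrable lborel (\<lambda>x. (P + Q) * inverse (1 + x ^ 2))"
    using integrable_inverse_1_plus_square_real by simp
  show g: "integrable lborel g"
  proof (rule Bochner_Integration.integrable_bound[OF int])
    show "AE x in lborel. norm (g x) \<le> norm ((P + Q) * inverse (1 + x ^ 2))"
      using le order_trans[OF le abs_ge_self] by simp
  qed simp
  have "(LINT x|lborel. norm (g x)) \<le> (LINT x|lborel. (P + Q) * inverse (1 + x ^ 2))"
    using g int le by (intro integral_mono) auto
  then show "(LINT x|lborel. norm (g x)) \<le> pi * (P + Q)"
    by (simp add: integral_inverse_1_plus_square_real mult.commute)
qed

lemma decays_moments:
  fixes f :: "real \<Rightarrow> complex"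
  assumes f: "f \<in> borel_measurable borel" "\<And>n x. norm (of_real (x ^ n) * f x) \<le> c n"
  shows "integrable lborel (\<lambda>x. of_real x ^ n * f x)"
    "(LINT x|lborel. norm (of_real x ^ n * f x)) \<le> pi * (c n + c (n + 2))"
proof -
  have m: "(\<lambda>x. of_real x ^ n * f x) \<in> borel_measurable borel"
    using f(1) by (intro borel_measurable_times borel_measurable_power) auto
  have 1: "norm (of_real x ^ n * f x) \<le> c n" for x using f(2)[of x n] by (simp only: of_real_power)
  have 2: "x ^ 2 * norm (of_real x ^ n * f x) \<le> c (n + 2)" for x
    using f(2)[of x "n + 2"]
    by (simp only: norm_mult norm_power norm_of_real power_add power_abs abs_mult abs_power2 power2_abs mult_ac)
  show "integrable lborel (\<lambda>x. of_real x ^ n * f x)"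
    "(LINT x|lborel. norm (of_real x ^ n * f x)) \<le> pi * (c n + c (n + 2))"
    using integrable_of_bounds[OF m 1 2] by auto
qed

text \<open>The n-th derivative of the transform is the transform of (- 2 * pi * \<i> * x) ^ n * f,
  hence bounded by an absolute moment of f. Only the factor (2 * pi) ^ n and the shift from n to n +
  2, caused by integrating, must be absorbed. The lemma is also applied to transforms.\<close>

lemma fourier_of_decays:
  assumes \<sigma>: "\<sigma> > 1" and f: "f \<in> borel_measurable borel" "decays \<sigma> f"
  shows "integrable lborel f" "smooth (fourier f)" "derivs_bounded \<sigma> (fourier f)"
proof -
  have dec: "\<exists>C>0. \<forall>n x. norm (of_real (x ^ n) * f x) \<le> C * weight \<tau> \<sigma> n" if "\<tau> > 0" for \<tau>
    using f(2) that by (simp add: weight_bounded_def)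
  obtain C where C: "\<And>n x. norm (of_real (x ^ n) * f x) \<le> C * weight 1 \<sigma> n"
    using dec[of 1] by auto
  note int = decays_moments(1)[OF f(1) C]
  show "integrable lborel f" using int[of 0] by simp
  note fam = deriv_family_fourier[OF int]
  show "smooth (fourier f)" using smooth_family[OF fam] by simp
  have nd: "nth_deriv n (fourier f) = fourier (\<lambda>x. (- (2 * of_real pi * \<i> * of_real x)) ^ n * f x)" for n
    using nth_deriv_eq_family[OF fam, of n] by simp
  have bound: "norm (nth_deriv n (fourier f) x) \<le> (2 * pi) ^ n * (pi * (c n + c (n + 2)))"
    if "\<And>n x. norm (of_real (x ^ n) * f x) \<le> c n" for n x c
  proof -
    have eq: "(- (2 * of_real pi * \<i> * of_real x)) ^ n * f x
        = (- (2 * of_real pi * \<i>)) ^ n * (of_real x ^ n * f x)" for x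
      by (rule scaled_power_times)
    have "norm (nth_deriv n (fourier f) x)
        \<le> (LINT x|lborel. norm ((- (2 * of_real pi * \<i>)) ^ n * (of_real x ^ n * f x)))"
      unfolding nd eq using int by (intro norm_fourier_le integrable_mult_right)
    also have "\<dots> = (2 * pi) ^ n * (LINT x|lborel. norm (of_real x ^ n * f x))"
      by (simp add: norm_mult norm_power)
    also have "\<dots> \<le> (2 * pi) ^ n * (pi * (c n + c (n + 2)))"
      by (intro mult_left_mono decays_moments[OF f(1) that]) auto
    finally show ?thesis .
  qed
  show "derivs_bounded \<sigma> (fourier f)" unfolding weight_bounded_def
  proof (intro allI impI)
    fix \<tau> :: real assume \<tau>: "\<tau> > 0"
    \<comment> \<open>Dilation by 2 covers the shift because n + 2 \<le> 2 * (n + 1). It uses half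
      of \<tau>; the other half takes care of (2 * pi) ^ n.\<close>
    obtain \<tau>' C1 where t: "\<tau>' > 0" "C1 > 0"
      "\<And>a n. real n \<le> 2 * (real a + 1) \<Longrightarrow> weight \<tau>' \<sigma> n \<le> C1 * weight (\<tau> / 2) \<sigma> a"
      using weight_dilate[of "\<tau> / 2" \<sigma> 2] \<tau> \<sigma> by auto
    obtain C2 where C2: "C2 > 0" "\<And>n. (2 * pi) ^ n \<le> C2 * weight (\<tau> / 2) \<sigma> n"
      using weight_absorb_power[of "\<tau> / 2" \<sigma> "2 * pi"] \<tau> \<sigma> by auto
    obtain C3 where C3: "C3 > 0" "\<And>n x. norm (of_real (x ^ n) * f x) \<le> C3 * weight \<tau>' \<sigma> n"
      using dec[OF t(1)] by auto
    have "norm (nth_deriv n (fourier f) x) \<le> (2 * pi * C1 * C2 * C3) * weight \<tau> \<sigma> n" for n x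
    proof -
      let ?W = "weight (\<tau> / 2) \<sigma> n"
      have "norm (nth_deriv n (fourier f) x)
          \<le> (2 * pi) ^ n * (pi * (C3 * weight \<tau>' \<sigma> n + C3 * weight \<tau>' \<sigma> (n + 2)))"
        by (rule bound[OF C3(2)])
      also have "\<dots> \<le> (C2 * ?W) * (pi * (C3 * (C1 * ?W) + C3 * (C1 * ?W)))"
        using C2 C3(1) t(3)[of n n] t(3)[of "n + 2" n] less_imp_le[OF weight_pos]
        by (intro mult_mono add_mono) (auto intro!: mult_nonneg_nonneg add_nonneg_nonneg)
      also have "\<dots> = (2 * pi * C1 * C2 * C3) * (?W * ?W)" by (simp add: algebra_simps)
      finally show ?thesis by (simp add: weight_mult)
    qed
    then show "\<exists>C>0. \<forall>n x. norm (nth_deriv n (fourier f) x) \<le> C * weight \<tau> \<sigma> n"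
      using t C2 C3 by (intro exI[of _ "2 * pi * C1 * C2 * C3"]) auto
  qed
qed

text \<open>Integration by parts, in the form that the derivative of f times the wave has integral 0
  over the line: it is integrable and its primitive vanishes at both ends.\<close>

lemma fourier_derivative:
  assumes d: "\<And>x. (f has_vector_derivative f' x) (at x)" and c: "\<And>x. isCont f' x"
    and int: "integrable lborel f" "integrable lborel f'"
    and lim: "(f \<longlongrightarrow> 0) at_top" "(f \<longlongrightarrow> 0) at_bot"
  shows "fourier f' \<xi> = 2 * of_real pi * \<i> * of_real \<xi> * fourier f \<xi>"
proof -
  let ?k = "2 * of_real pi * \<i> * of_real \<xi> :: complex"
  let ?h = "\<lambda>x. f' x * wave x \<xi> - ?k * (f x * wave x \<xi>)"
  have fc: "isCont f x" for x using d has_vector_derivative_continuous by blast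
  have w: "((\<lambda>x. wave x \<xi>) has_vector_derivative (- ?k * wave x \<xi>)) (at x)" for x
  proof -
    have "((\<lambda>z. exp (- (2 * of_real pi * \<i> * z * of_real \<xi>))) has_field_derivative
        (- ?k * wave x \<xi>)) (at (of_real x))"
      by (auto intro!: derivative_eq_intros)
    then show ?thesis by (rule has_vector_derivative_real_field)
  qed
  have hd: "((\<lambda>x. f x * wave x \<xi>) has_vector_derivative ?h x) (at x)" for x
    using has_vector_derivative_mult[OF d w, of x] by (simp add: algebra_simps)
  have i1: "integrable lborel (\<lambda>x. f' x * wave x \<xi>)" "integrable lborel (\<lambda>x. ?k * (f x * wave x \<xi>))"
    using int by (intro integrable_times_wave integrable_mult_right; simp)+
  then have hi: "integrable lborel ?h" by simp
  have lim0: "((\<lambda>x. f x * wave x \<xi>) \<longlongrightarrow> 0) F" if "(f \<longlongrightarrow> 0) F" for F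
  proof (rule Lim_null_comparison)
    show "eventually (\<lambda>x. norm (f x * wave x \<xi>) \<le> norm (f x)) F" by (simp add: norm_mult)
    show "((\<lambda>x. norm (f x)) \<longlongrightarrow> 0) F" using that by (rule tendsto_norm_zero)
  qed
  have "(LBINT x=-\<infinity>..\<infinity>. ?h x) = 0 - 0"
  proof (rule interval_integral_FTC_integrable[where F = "\<lambda>x. f x * wave x \<xi>"])
    show "isCont ?h x" for x using c fc by (intro continuous_intros) auto
    show "set_integrable lborel (einterval (-\<infinity>) \<infinity>) ?h" using hi by (simp add: set_integrable_def)
  qed (use hd lim0 lim in \<open>auto simp: ereal_tendsto_simps\<close>)
  then have "(LINT x|lborel. ?h x) = 0"
    by (simp add: interval_lebesgue_integral_def set_lebesgue_integral_def)
  then have "(LINT x|lborel. f' x * wave x \<xi>) - (LINT x|lborel. ?k * (f x * wave x \<xi>)) = 0"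
    using Bochner_Integration.integral_diff[OF i1] by simp
  then show ?thesis by (simp add: fourier_def)
qed

text \<open>Here the mixed bounds are used, for powers up to 2 of x: powers 0 and 2 make each
  derivative integrable, power 1 makes it vanish at infinity.\<close>

lemma fourier_nth_deriv:
  assumes "f \<in> gelfand_shilov \<sigma>"
  shows "integrable lborel (nth_deriv b f)"
    "fourier (nth_deriv b f) \<xi> = (2 * of_real pi * \<i> * of_real \<xi>) ^ b * fourier f \<xi>"
proof -
  have fam: "deriv_family (\<lambda>n. nth_deriv n f)"
    using assms by (intro deriv_family_nth_deriv) (simp add: gelfand_shilov_def)
  then have d: "(nth_deriv b f has_vector_derivative nth_deriv (Suc b) f x) (at x)" for b x
    by (simp add: deriv_family_def)
  have c: "isCont (nth_deriv b f) x" for b x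
    using d has_vector_derivative_continuous by blast
  have "\<forall>\<tau>>0. \<exists>C>0. \<forall>a b x. norm (of_real (x ^ a) * nth_deriv b f x) \<le> C * weight \<tau> \<sigma> a * weight \<tau> \<sigma> b"
    using assms unfolding gelfand_shilov_def by blast
  then obtain C where C: "\<And>a b x. norm (of_real (x ^ a) * nth_deriv b f x) \<le> C * weight 1 \<sigma> a * weight 1 \<sigma> b"
    using zero_less_one by meson
  have m: "nth_deriv b f \<in> borel_measurable borel" for b
    by (rule borel_measurable_continuous_onI) (simp add: continuous_on_eq_continuous_at c)
  have int: "integrable lborel (nth_deriv b f)" for b
  proof (rule integrable_of_bounds(1)[OF m])
    show "norm (nth_deriv b f x) \<le> C * weight 1 \<sigma> 0 * weight 1 \<sigma> b" for x
      using C[of x 0 b] by simp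
    show "x ^ 2 * norm (nth_deriv b f x) \<le> C * weight 1 \<sigma> 2 * weight 1 \<sigma> b" for x
      using C[of x 2 b] by (simp add: norm_mult norm_power)
  qed
  then show "integrable lborel (nth_deriv b f)" .
  have lim: "(nth_deriv b f \<longlongrightarrow> 0) at_infinity" for b
  proof (rule Lim_null_comparison)
    let ?c = "C * weight 1 \<sigma> 1 * weight 1 \<sigma> b"
    show "((\<lambda>x::real. norm (?c / x)) \<longlongrightarrow> 0) at_infinity"
      by (intro tendsto_norm_zero tendsto_divide_0[OF tendsto_const] filterlim_ident)
    have "norm (nth_deriv b f x) \<le> norm (?c / x)" if "x \<noteq> 0" for x
    proof -
      have "\<bar>x\<bar> * norm (nth_deriv b f x) \<le> \<bar>?c\<bar>"
        using C[of x 1 b] by (simp add: norm_mult)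
      then show ?thesis using that by (simp add: field_simps)
    qed
    moreover have "eventually (\<lambda>x::real. x \<noteq> 0) at_infinity"
      using eventually_not_equal_at_infinity by blast
    ultimately show "eventually (\<lambda>x. norm (nth_deriv b f x) \<le> norm (?c / x)) at_infinity"
      by (rule eventually_mono[rotated])
  qed
  show "fourier (nth_deriv b f) \<xi> = (2 * of_real pi * \<i> * of_real \<xi>) ^ b * fourier f \<xi>"
  proof (induction b)
    case (Suc b)
    have "fourier (nth_deriv (Suc b) f) \<xi> = 2 * of_real pi * \<i> * of_real \<xi> * fourier (nth_deriv b f) \<xi>"
      by (rule fourier_derivative[OF d c int int])
        (rule tendsto_mono[OF at_top_le_at_infinity lim], rule tendsto_mono[OF at_bot_le_at_infinity lim])
    then show ?case by (simp only: Suc.IH power_Suc mult.assoc)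
  qed simp
qed

text \<open>Multiplying the transform by (2 * pi * \<bar>\<xi>\<bar>) ^ n gives the size of the
  transform of the n-th derivative, at most its integral norm. The factor (2 * pi) ^ n is at least 1
  and is dropped, and the weight at index 2 is a constant, so \<tau> does not change.\<close>

lemma decays_fourier:
  assumes "f \<in> gelfand_shilov \<sigma>"
  shows "decays \<sigma> (fourier f)"
  unfolding weight_bounded_def
proof (intro allI impI)
  fix \<tau> :: real assume \<tau>: "\<tau> > 0"
  obtain C where C: "C > 0"
    "\<And>a b x. norm (of_real (x ^ a) * nth_deriv b f x) \<le> C * weight \<tau> \<sigma> a * weight \<tau> \<sigma> b"
    using assms \<tau> by (auto simp: gelfand_shilov_def)
  have "norm (of_real (\<xi> ^ n) * fourier f \<xi>) \<le> (pi * (C * (1 + weight \<tau> \<sigma> 2))) * weight \<tau> \<sigma> n" for n \<xi>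
  proof -
    have "1 ^ n * (\<bar>\<xi>\<bar> ^ n * norm (fourier f \<xi>)) \<le> (2 * pi) ^ n * (\<bar>\<xi>\<bar> ^ n * norm (fourier f \<xi>))"
      using pi_ge_two by (intro mult_right_mono power_mono) auto
    also have "\<dots> = norm (fourier (nth_deriv n f) \<xi>)"
      unfolding fourier_nth_deriv(2)[OF assms] by (simp add: norm_mult norm_power power_mult_distrib)
    also have "\<dots> \<le> (LINT x|lborel. norm (nth_deriv n f x))"
      by (intro norm_fourier_le fourier_nth_deriv[OF assms])
    also have "\<dots> \<le> pi * (C * weight \<tau> \<sigma> 0 * weight \<tau> \<sigma> n + C * weight \<tau> \<sigma> 2 * weight \<tau> \<sigma> n)"
    proof (rule integrable_of_bounds(2))
      show "nth_deriv n f \<in> borel_measurable borel"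
        using borel_measurable_integrable[OF fourier_nth_deriv(1)[OF assms]] by simp
      show "norm (nth_deriv n f x) \<le> C * weight \<tau> \<sigma> 0 * weight \<tau> \<sigma> n" for x
        using C(2)[of x 0 n] by simp
      show "x ^ 2 * norm (nth_deriv n f x) \<le> C * weight \<tau> \<sigma> 2 * weight \<tau> \<sigma> n" for x
        using C(2)[of x 2 n] by (simp add: norm_mult norm_power)
    qed
    also have "\<dots> = (pi * (C * (1 + weight \<tau> \<sigma> 2))) * weight \<tau> \<sigma> n"
      by (simp add: weight_def[of _ _ 0] algebra_simps)
    finally show ?thesis by (simp add: norm_mult norm_power)
  qed
  moreover have "pi * (C * (1 + weight \<tau> \<sigma> 2)) > 0"
    using C(1) weight_pos[of \<tau> \<sigma> 2] by (simp add: add_pos_pos)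
  ultimately show "\<exists>C>0. \<forall>n x. norm (of_real (x ^ n) * fourier f x) \<le> C * weight \<tau> \<sigma> n" by blast
qed

section \<open>Fourier inversion\<close>

text \<open>Fubini for a kernel symmetric in both variables. With g a modulated Gaussian it turns
  the regularized inversion integral into an average of f against a normal density.\<close>

lemma fourier_multiplication_formula:
  assumes f: "integrable lborel f" and g: "integrable lborel g"
  shows "(LINT \<xi>|lborel. fourier f \<xi> * g \<xi>) = (LINT y|lborel. f y * fourier g y)"
proof -
  have [measurable]: "f \<in> borel_measurable lborel" "g \<in> borel_measurable lborel"
    using f g by auto
  let ?h = "\<lambda>y \<xi>. f y * g \<xi> * wave y \<xi>"
  have int: "integrable (lborel \<Otimes>\<^sub>M lborel) (case_prod ?h)"
  proof (rule lborel_pair.Fubini_integrable)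
    show "case_prod ?h \<in> borel_measurable (lborel \<Otimes>\<^sub>M lborel)" by measurable
    have "(LINT \<xi>|lborel. norm (?h y \<xi>)) = norm (f y) * (LINT \<xi>|lborel. norm (g \<xi>))" for y
      by (simp add: norm_mult)
    then show "integrable lborel (\<lambda>y. LINT \<xi>|lborel. norm (case (y, \<xi>) of (y, \<xi>) \<Rightarrow> ?h y \<xi>))"
      using f by simp
    have "integrable lborel (\<lambda>\<xi>. f y * (g \<xi> * wave \<xi> y))" for y
      by (intro integrable_mult_right integrable_times_wave g)
    then show "AE y in lborel. integrable lborel (\<lambda>\<xi>. case (y, \<xi>) of (y, \<xi>) \<Rightarrow> ?h y \<xi>)"
      by (intro AE_I2) (simp add: mult_ac)
  qed
  have "(LINT \<xi>|lborel. fourier f \<xi> * g \<xi>) = (LINT \<xi>|lborel. LINT y|lborel. ?h y \<xi>)"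
  proof (rule Bochner_Integration.integral_cong[OF refl])
    fix \<xi>
    have "(LINT y|lborel. ?h y \<xi>) = (LINT y|lborel. f y * wave y \<xi> * g \<xi>)"
      by (rule Bochner_Integration.integral_cong[OF refl]) (simp only: mult_ac)
    then show "fourier f \<xi> * g \<xi> = (LINT y|lborel. ?h y \<xi>)"
      by (simp add: fourier_def)
  qed
  also have "\<dots> = (LINT y|lborel. LINT \<xi>|lborel. ?h y \<xi>)"
    by (rule lborel_pair.Fubini_integral[OF int])
  also have "\<dots> = (LINT y|lborel. f y * fourier g y)"
  proof (rule Bochner_Integration.integral_cong[OF refl])
    fix y
    have "(LINT \<xi>|lborel. ?h y \<xi>) = (LINT \<xi>|lborel. f y * (g \<xi> * wave \<xi> y))"
      by (rule Bochner_Integration.integral_cong[OF refl]) (simp only: mult_ac)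
    then show "(LINT \<xi>|lborel. ?h y \<xi>) = f y * fourier g y"
      by (simp add: fourier_def)
  qed
  finally show ?thesis .
qed

text \<open>Normalized so that its Fourier transform is the centred normal density with standard
  deviation s.\<close>

definition gauss :: "real \<Rightarrow> real \<Rightarrow> real" where
  "gauss s \<xi> = exp (- (2 * pi * s * \<xi>)\<^sup>2 / 2)"

lemma integral_std_normal_iexp:
  "(LINT u|lborel. std_normal_density u *\<^sub>R iexp (t * u)) = of_real (exp (- t\<^sup>2 / 2))"
proof -
  have "char std_normal_distribution t = (LINT u|lborel. std_normal_density u *\<^sub>R iexp (t * u))"
    unfolding char_def by (rule integral_density) auto
  then show ?thesis by (simp only: char_std_normal_distribution)
qed

text \<open>Substitute u = 2 * pi * s * \<xi> in the characteristic function of the standard normal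
  distribution, taken at - z / s. The summands \<open>0 +\<close> reproduce the shape of an affine
  change of variables.\<close>

lemma fourier_gauss:
  assumes s: "s > 0"
  shows "integrable lborel (\<lambda>\<xi>. complex_of_real (gauss s \<xi>))"
    "fourier (\<lambda>\<xi>. of_real (gauss s \<xi>)) z = of_real (normal_density 0 s z)"
proof -
  have dens: "std_normal_density (0 + 2 * pi * s * \<xi>) = gauss s \<xi> / sqrt (2 * pi)" for \<xi>
    by (simp add: std_normal_density_def gauss_def)
  have "integrable lborel (\<lambda>\<xi>. std_normal_density (0 + 2 * pi * s * \<xi>))"
    using s by (intro lborel_integrable_real_affine) auto
  then have "integrable lborel (\<lambda>\<xi>. gauss s \<xi> / sqrt (2 * pi))" unfolding dens .
  then have "integrable lborel (\<lambda>\<xi>. sqrt (2 * pi) * (gauss s \<xi> / sqrt (2 * pi)))"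
    by (rule integrable_mult_right)
  then have "integrable lborel (gauss s)" by simp
  then show "integrable lborel (\<lambda>\<xi>. complex_of_real (gauss s \<xi>))" by (rule integrable_of_real)
  have "of_real (exp (- (- (z / s))\<^sup>2 / 2)) = (LINT u|lborel. std_normal_density u *\<^sub>R iexp (- (z / s) * u))"
    by (rule integral_std_normal_iexp[symmetric])
  also have "\<dots> = \<bar>2 * pi * s\<bar> *\<^sub>R (LINT \<xi>|lborel. std_normal_density (0 + 2 * pi * s * \<xi>) *\<^sub>R
      iexp (- (z / s) * (0 + 2 * pi * s * \<xi>)))"
    using s by (intro lborel_integral_real_affine) auto
  also have "(LINT \<xi>|lborel. std_normal_density (0 + 2 * pi * s * \<xi>) *\<^sub>R
      iexp (- (z / s) * (0 + 2 * pi * s * \<xi>)))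
    = (LINT \<xi>|lborel. of_real (1 / sqrt (2 * pi)) * (of_real (gauss s \<xi>) * wave \<xi> z))"
  proof (rule Bochner_Integration.integral_cong[OF refl])
    fix \<xi>
    have "iexp (- (z / s) * (0 + 2 * pi * s * \<xi>)) = wave \<xi> z"
      unfolding wave_eq_iexp using s by (simp add: mult_ac)
    then show "std_normal_density (0 + 2 * pi * s * \<xi>) *\<^sub>R iexp (- (z / s) * (0 + 2 * pi * s * \<xi>))
        = of_real (1 / sqrt (2 * pi)) * (of_real (gauss s \<xi>) * wave \<xi> z)"
      unfolding dens by (simp add: scaleR_conv_of_real)
  qed
  also have "\<dots> = of_real (1 / sqrt (2 * pi)) * fourier (\<lambda>\<xi>. of_real (gauss s \<xi>)) z"
    unfolding fourier_def by (rule integral_mult_right_zero)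
  finally have "of_real (exp (- (- (z / s))\<^sup>2 / 2))
      = of_real (2 * pi * s / sqrt (2 * pi)) * fourier (\<lambda>\<xi>. of_real (gauss s \<xi>)) z"
    using s by (simp add: scaleR_conv_of_real)
  then have "fourier (\<lambda>\<xi>. of_real (gauss s \<xi>)) z
      = of_real (exp (- (- (z / s))\<^sup>2 / 2) / (2 * pi * s / sqrt (2 * pi)))"
    using s by (simp add: field_simps)
  also have "2 * pi * s / sqrt (2 * pi) = sqrt (2 * pi * s\<^sup>2)"
  proof -
    have "2 * pi * s / sqrt (2 * pi) = (2 * pi) / sqrt (2 * pi) * s" by simp
    also have "\<dots> = sqrt (2 * pi) * s" by (subst real_div_sqrt) auto
    also have "\<dots> = sqrt (2 * pi * s\<^sup>2)" using s by (simp add: real_sqrt_mult)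
    finally show ?thesis .
  qed
  finally show "fourier (\<lambda>\<xi>. of_real (gauss s \<xi>)) z = of_real (normal_density 0 s z)"
    by (simp add: normal_density_def power_divide)
qed

text \<open>From exp w \<ge> 1 + w with w = z ^ 2 / (2 * s ^ 2), the exponential factor is at most 2
  * s ^ 2, and the normalization is at most 1 / s. The kernel thus tends to 0 uniformly outside the
  unit interval.\<close>

lemma normal_density_le:
  assumes s: "s > 0" and z: "\<bar>z\<bar> \<ge> 1"
  shows "normal_density 0 s z \<le> 2 * s"
proof -
  have z2: "z\<^sup>2 \<ge> 1" using power_mono[OF z, of 2] by simp
  have "1 / (2 * s\<^sup>2) \<le> z\<^sup>2 / (2 * s\<^sup>2)" using z2 by (intro divide_right_mono) auto
  also have "\<dots> \<le> exp (z\<^sup>2 / (2 * s\<^sup>2))" using exp_ge_add_one_self[of "z\<^sup>2 / (2 * s\<^sup>2)"] by linarith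
  finally have e: "exp (- (z\<^sup>2 / (2 * s\<^sup>2))) \<le> 2 * s\<^sup>2"
    using s by (simp add: exp_minus field_simps)
  have "s \<le> sqrt (2 * pi * s\<^sup>2)"
    using s pi_ge_two mult_right_mono[of 1 "2 * pi" "s\<^sup>2"] by (intro real_le_rsqrt) simp
  then have "1 / sqrt (2 * pi * s\<^sup>2) * exp (- (z\<^sup>2 / (2 * s\<^sup>2))) \<le> 1 / s * (2 * s\<^sup>2)"
    using s e by (intro mult_mono divide_left_mono) auto
  also have "\<dots> = 2 * s" using s by (simp add: power2_eq_square)
  finally show ?thesis by (simp add: normal_density_def)
qed

text \<open>A continuous integrable f may be unbounded, so dominated convergence is available only
  near x. The far part is handled by integrability of f and smallness of the kernel there.\<close>

lemma gauss_approximate_identity: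
  fixes f :: "real \<Rightarrow> complex"
  assumes f: "integrable lborel f" and c: "\<And>x. isCont f x"
    and s: "\<And>k. s k > 0" "s \<longlonglongrightarrow> 0"
  shows "(\<lambda>k. LINT y|lborel. f y * of_real (normal_density 0 (s k) (y - x))) \<longlonglongrightarrow> f x"
proof -
  define U where "U = {x - 1 <..< x + 1}"
  define A where "A = (\<lambda>y. indicator U y *\<^sub>R f y)"
  define B where "B = (\<lambda>y. indicator (- U) y *\<^sub>R f y)"
  have [measurable]: "f \<in> borel_measurable lborel" using f by auto
  have fm [measurable]: "f \<in> borel_measurable borel" using f by simp
  have Um [measurable]: "U \<in> sets borel" by (simp add: U_def)
  have Am [measurable]: "A \<in> borel_measurable borel" unfolding A_def by measurable
  have Bm [measurable]: "B \<in> borel_measurable borel" unfolding B_def by measurable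
  obtain M where M: "\<And>y. y \<in> {x-1..x+1} \<Longrightarrow> norm (f y) \<le> M"
  proof -
    have "compact (f ` {x-1..x+1})"
      by (intro compact_continuous_image continuous_at_imp_continuous_on) (use c in auto)
    then have "bounded (f ` {x-1..x+1})" by (rule compact_imp_bounded)
    then obtain M where "\<forall>z\<in>f ` {x-1..x+1}. norm z \<le> M" unfolding bounded_iff by blast
    then show ?thesis by (intro that[of M]) auto
  qed
  have M0: "M \<ge> 0" using order_trans[OF norm_ge_zero M[of x]] by simp
  have AM: "norm (A y) \<le> M" for y
    using M[of y] M0 by (auto simp: A_def U_def indicator_def)
  have nd_int: "integrable lborel (\<lambda>y. normal_density 0 t (y - x))" if "t > 0" for t
    using lborel_integrable_real_affine[OF integrable_normal_density[OF that, of 0], of 1 "-x"] by simp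
  have intA: "integrable lborel (\<lambda>y. A y * of_real (normal_density 0 t (y - x)))" if "t > 0" for t
  proof (rule Bochner_Integration.integrable_bound)
    show "integrable lborel (\<lambda>y. M * normal_density 0 t (y - x))" using nd_int[OF that] by simp
    show "AE y in lborel. norm (A y * of_real (normal_density 0 t (y - x))) \<le> norm (M * normal_density 0 t (y - x))"
      using AM M0 by (auto simp: norm_mult intro!: mult_right_mono)
  qed measurable
  have normB: "norm (B y * of_real (normal_density 0 t (y - x))) \<le> (2 * t) * norm (f y)" if "t > 0" for t y
  proof (cases "y \<in> U")
    case False
    then have "\<bar>y - x\<bar> \<ge> 1" by (auto simp: U_def)
    then have "normal_density 0 t (y - x) \<le> 2 * t" using that by (intro normal_density_le)
    then show ?thesis using False by (simp add: B_def norm_mult mult_left_mono mult.commute)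
  qed (use that in \<open>simp add: B_def\<close>)
  have intB: "integrable lborel (\<lambda>y. B y * of_real (normal_density 0 t (y - x)))" if "t > 0" for t
  proof (rule Bochner_Integration.integrable_bound)
    show "integrable lborel (\<lambda>y. (2 * t) * norm (f y))" using f by simp
    show "AE y in lborel. norm (B y * of_real (normal_density 0 t (y - x))) \<le> norm ((2 * t) * norm (f y))"
      using order_trans[OF normB[OF that] abs_ge_self] by simp
  qed measurable
  have "(\<lambda>k. LINT y|lborel. B y * of_real (normal_density 0 (s k) (y - x))) \<longlonglongrightarrow> 0"
  proof (rule Lim_null_comparison)
    have "norm (LINT y|lborel. B y * of_real (normal_density 0 (s k) (y - x)))
        \<le> (2 * s k) * (LINT y|lborel. norm (f y))" for k
    proof -
      have "norm (LINT y|lborel. B y * of_real (normal_density 0 (s k) (y - x)))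
          \<le> (LINT y|lborel. norm (B y * of_real (normal_density 0 (s k) (y - x))))"
        by (rule integral_norm_bound)
      also have "\<dots> \<le> (LINT y|lborel. (2 * s k) * norm (f y))"
        using normB[OF s(1)] intB[OF s(1)] f by (intro integral_mono) auto
      finally show ?thesis by simp
    qed
    then show "eventually (\<lambda>k. norm (LINT y|lborel. B y * of_real (normal_density 0 (s k) (y - x)))
        \<le> (2 * s k) * (LINT y|lborel. norm (f y))) sequentially" by simp
    show "(\<lambda>k. (2 * s k) * (LINT y|lborel. norm (f y))) \<longlonglongrightarrow> 0"
      using s(2) by (auto intro!: tendsto_eq_intros)
  qed
  moreover have "(\<lambda>k. LINT y|lborel. A y * of_real (normal_density 0 (s k) (y - x))) \<longlonglongrightarrow> f x"
  proof -
    \<comment> \<open>The substitution y = x + t * u moves the parameter from the kernel into the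
      argument of A; the kernel becomes a fixed majorant.\<close>
    have eq: "(LINT y|lborel. A y * of_real (normal_density 0 t (y - x)))
        = (LINT u|lborel. A (x + t * u) * of_real (std_normal_density u))" if t: "t > 0" for t
    proof -
      have "(LINT y|lborel. A y * of_real (normal_density 0 t (y - x)))
          = \<bar>t\<bar> *\<^sub>R (LINT u|lborel. A (x + t * u) * of_real (normal_density 0 t (x + t * u - x)))"
        using t by (intro lborel_integral_real_affine) auto
      also have "\<dots> = (LINT u|lborel. \<bar>t\<bar> *\<^sub>R (A (x + t * u) * of_real (normal_density 0 t (x + t * u - x))))"
        by (rule integral_scaleR_right[symmetric])
      also have "\<dots> = (LINT u|lborel. A (x + t * u) * of_real (std_normal_density u))"
      proof (rule Bochner_Integration.integral_cong[OF refl])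
        fix u
        have "t * normal_density 0 t (x + t * u - x) = std_normal_density u"
          using t by (simp add: normal_density_def real_sqrt_mult power_mult_distrib)
        then show "\<bar>t\<bar> *\<^sub>R (A (x + t * u) * of_real (normal_density 0 t (x + t * u - x)))
            = A (x + t * u) * of_real (std_normal_density u)"
          using t by (simp add: scaleR_conv_of_real mult.left_commute flip: of_real_mult)
      qed
      finally show ?thesis .
    qed
    \<comment> \<open>Truncation may create jumps at the ends of U, but U is a neighbourhood of
      x.\<close>
    have Ac: "isCont A x"
    proof -
      have "eventually (\<lambda>y. y \<in> U) (nhds x)"
        by (rule eventually_nhds_in_open) (auto simp: U_def)
      then have "eventually (\<lambda>y. A y = f y) (nhds x)"
        by (rule eventually_mono) (simp add: A_def)
      then show ?thesis using c isCont_cong by blast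
    qed
    have Ax: "A x = f x" by (simp add: A_def U_def)
    have "(\<lambda>k. LINT u|lborel. A (x + s k * u) * of_real (std_normal_density u))
        \<longlonglongrightarrow> (LINT u|lborel. f x * of_real (std_normal_density u))"
    proof (rule integral_dominated_convergence)
      show "integrable lborel (\<lambda>u. M * std_normal_density u)" by simp
      show "AE u in lborel. norm (A (x + s k * u) * of_real (std_normal_density u)) \<le> M * std_normal_density u" for k
        using AM by (auto simp: norm_mult intro!: mult_right_mono)
      show "AE u in lborel. (\<lambda>k. A (x + s k * u) * of_real (std_normal_density u))
          \<longlonglongrightarrow> f x * of_real (std_normal_density u)"
      proof (intro AE_I2 tendsto_mult tendsto_const)
        fix u
        have "(\<lambda>k. x + s k * u) \<longlonglongrightarrow> x" using s(2) by (auto intro!: tendsto_eq_intros)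
        then show "(\<lambda>k. A (x + s k * u)) \<longlonglongrightarrow> f x"
          using isCont_tendsto_compose[OF Ac] Ax by simp
      qed
    qed measurable
    moreover have "(LINT u|lborel. f x * complex_of_real (std_normal_density u)) = f x"
      using integral_normal_density[of 1 0] by (simp del: integral_normal_density add: integral_complex_of_real)
    ultimately show ?thesis using eq[OF s(1)] by simp
  qed
  ultimately have "(\<lambda>k. (LINT y|lborel. B y * of_real (normal_density 0 (s k) (y - x)))
      + (LINT y|lborel. A y * of_real (normal_density 0 (s k) (y - x)))) \<longlonglongrightarrow> 0 + f x"
    by (rule tendsto_add)
  moreover have "(LINT y|lborel. f y * of_real (normal_density 0 (s k) (y - x)))
      = (LINT y|lborel. B y * of_real (normal_density 0 (s k) (y - x)))
        + (LINT y|lborel. A y * of_real (normal_density 0 (s k) (y - x)))" for k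
  proof -
    have "f y * of_real (normal_density 0 (s k) (y - x))
        = B y * of_real (normal_density 0 (s k) (y - x)) + A y * of_real (normal_density 0 (s k) (y - x))" for y
      by (simp add: A_def B_def indicator_def)
    then show ?thesis using Bochner_Integration.integral_add[OF intB[OF s(1)] intA[OF s(1)]] by simp
  qed
  ultimately show ?thesis by simp
qed

text \<open>A Gaussian factor makes the inversion integral accessible to the multiplication formula.
  As its parameter tends to 0, one side converges to the inversion integral, with the norm of the
  transform as majorant, and the other to f x.\<close>

lemma fourier_inversion:
  assumes f: "integrable lborel f" "integrable lborel (fourier f)" and c: "\<And>x. isCont f x"
  shows "f x = fourier (fourier f) (- x)"
proof -
  define s where "s = (\<lambda>k. 1 / real (Suc k))"
  have s: "s k > 0" "s \<longlonglongrightarrow> 0" for k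
    unfolding s_def using LIMSEQ_inverse_real_of_nat by (auto simp: inverse_eq_divide)
  \<comment> \<open>Modulation by the wave at - x translates the transform: it becomes the normal
    density centred at x.\<close>
  let ?g = "\<lambda>k \<xi>. of_real (gauss (s k) \<xi>) * wave \<xi> (- x)"
  have [measurable]: "fourier f \<in> borel_measurable lborel" using f by auto
  have gm [measurable]: "gauss t \<in> borel_measurable borel" for t
    unfolding gauss_def[abs_def] by measurable
  have wm [measurable]: "(\<lambda>\<xi>. wave \<xi> (- x)) \<in> borel_measurable borel"
    by (rule wave_measurable)
  have eq: "(LINT \<xi>|lborel. fourier f \<xi> * ?g k \<xi>) = (LINT y|lborel. f y * of_real (normal_density 0 (s k) (y - x)))" for k
  proof -
    have "fourier (?g k) y = of_real (normal_density 0 (s k) (y - x))" for y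
    proof -
      have "wave \<xi> (- x) * wave \<xi> y = wave \<xi> (y - x)" for \<xi>
        unfolding exp_add[symmetric] by (rule arg_cong[of _ _ exp]) (simp add: algebra_simps)
      then have "fourier (?g k) y = fourier (\<lambda>\<xi>. of_real (gauss (s k) \<xi>)) (y - x)"
        unfolding fourier_def mult.assoc by (simp only:)
      then show ?thesis using fourier_gauss(2)[OF s(1)] by simp
    qed
    then show ?thesis
      using fourier_multiplication_formula[OF f(1) integrable_times_wave[OF fourier_gauss(1)[OF s(1)]], of k "- x"]
      by simp
  qed
  have "(\<lambda>k. LINT \<xi>|lborel. fourier f \<xi> * ?g k \<xi>) \<longlonglongrightarrow> (LINT \<xi>|lborel. fourier f \<xi> * wave \<xi> (- x))"
  proof (rule integral_dominated_convergence)
    show "integrable lborel (\<lambda>\<xi>. norm (fourier f \<xi>))" using f by simp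
    show "AE \<xi> in lborel. norm (fourier f \<xi> * ?g k \<xi>) \<le> norm (fourier f \<xi>)" for k
      by (auto simp: norm_mult gauss_def intro!: mult_left_le)
    show "AE \<xi> in lborel. (\<lambda>k. fourier f \<xi> * ?g k \<xi>) \<longlonglongrightarrow> fourier f \<xi> * wave \<xi> (- x)"
    proof (intro AE_I2 tendsto_mult tendsto_const)
      fix \<xi>
      have "(\<lambda>k. gauss (s k) \<xi>) \<longlonglongrightarrow> exp (- (2 * pi * 0 * \<xi>)\<^sup>2 / 2)"
        unfolding gauss_def by (intro tendsto_intros s) auto
      then have "(\<lambda>k. complex_of_real (gauss (s k) \<xi>)) \<longlonglongrightarrow> of_real 1"
        by (intro tendsto_of_real) simp
      then have "(\<lambda>k. complex_of_real (gauss (s k) \<xi>) * wave \<xi> (- x)) \<longlonglongrightarrow> of_real 1 * wave \<xi> (- x)"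
        by (intro tendsto_mult tendsto_const)
      then show "(\<lambda>k. ?g k \<xi>) \<longlonglongrightarrow> wave \<xi> (- x)" by (simp only: of_real_1 mult_1)
    qed
  qed measurable
  moreover have "(\<lambda>k. LINT \<xi>|lborel. fourier f \<xi> * ?g k \<xi>) \<longlonglongrightarrow> f x"
    unfolding eq by (rule gauss_approximate_identity[OF f(1) c s])
  ultimately have "f x = (LINT \<xi>|lborel. fourier f \<xi> * wave \<xi> (- x))"
    by (rule LIMSEQ_unique[rotated])
  then show ?thesis by (simp only: fourier_def[of "fourier f"])
qed

section \<open>Equivalence of the conditions\<close>

lemma smooth_isCont: "smooth f \<Longrightarrow> isCont f x"
  unfolding smooth_def using differentiable_imp_continuous_within nth_deriv_0 by metis

lemma smooth_borel_measurable: "smooth f \<Longrightarrow> f \<in> borel_measurable borel"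
  by (intro borel_measurable_continuous_onI) (simp add: continuous_on_eq_continuous_at smooth_isCont)

text \<open>Decay of f gives derivative bounds for the transform and mixed bounds of f give its
  decay; the criterion by separate bounds does the rest.\<close>

lemma fourier_gelfand_shilov:
  assumes "\<sigma> > 1" "f \<in> gelfand_shilov \<sigma>"
  shows "fourier f \<in> gelfand_shilov \<sigma>"
  using assms gelfand_shilovD[OF assms(2)]
  by (intro gelfand_shilovI fourier_of_decays decays_fourier smooth_borel_measurable)

text \<open>Reflections enter because transforming twice gives back the function at - x.\<close>

lemma decays_reflect: "decays \<sigma> f \<Longrightarrow> decays \<sigma> (\<lambda>x. f (- x))"
proof -
  have "norm (of_real (x ^ n) * f (- x)) = norm (of_real ((- x) ^ n) * f (- x))" for n x
    by (simp add: norm_mult norm_power)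
  then show "decays \<sigma> f \<Longrightarrow> decays \<sigma> (\<lambda>x. f (- x))"
    unfolding weight_bounded_def by metis
qed

lemma derivs_bounded_reflect:
  assumes "smooth f" "derivs_bounded \<sigma> f"
  shows "derivs_bounded \<sigma> (\<lambda>x. f (- x))"
  using assms(2) unfolding weight_bounded_def nth_deriv_reflect[OF assms(1)]
  by (simp add: norm_mult norm_power) blast

lemma admissibleD:
  assumes "admissible \<alpha> \<beta>"
  obtains L where "strict_mono \<alpha>" "\<alpha> 0 = 0" "gap_bounded \<alpha> L" "strict_mono \<beta>" "\<beta> 0 = 0" "gap_bounded \<beta> L"
  using assms unfolding admissible_def by blast

lemma admissible_identity: "admissible (\<lambda>n. n) (\<lambda>n. n)"
  unfolding admissible_def
  by (auto simp: strict_mono_def filterlim_ident field_simps intro!: exI[of _ 2])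

lemma weight_bounded_pair:
  assumes "weight_bounded \<sigma> u" "weight_bounded \<sigma> v" "\<tau> > 0"
  shows "\<exists>C>0. \<forall>m n. (\<forall>x. u n x \<le> C * weight \<tau> \<sigma> n) \<and> (\<forall>x. v m x \<le> C * weight \<tau> \<sigma> m)"
proof -
  obtain C1 where C1: "C1 > 0" "\<And>n x. u n x \<le> C1 * weight \<tau> \<sigma> n"
    using assms by (auto simp: weight_bounded_def)
  obtain C2 where C2: "C2 > 0" "\<And>n x. v n x \<le> C2 * weight \<tau> \<sigma> n"
    using assms by (auto simp: weight_bounded_def)
  have "C1 * weight \<tau> \<sigma> n \<le> (C1 + C2) * weight \<tau> \<sigma> n" "C2 * weight \<tau> \<sigma> n \<le> (C1 + C2) * weight \<tau> \<sigma> n" for n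
    using C1 C2 weight_pos[of \<tau> \<sigma> n] by (auto intro!: mult_right_mono)
  then have "u n x \<le> (C1 + C2) * weight \<tau> \<sigma> n" "v n x \<le> (C1 + C2) * weight \<tau> \<sigma> n" for n x
    using C1(2) C2(2) order_trans by blast+
  then show ?thesis using C1 C2 by (intro exI[of _ "C1 + C2"]) auto
qed

text \<open>Multiplying by the exponential of the supremum means satisfying the power bounds for all
  n at once, so the parameter \<tau> and the sequence d stay the same.\<close>

lemma assoc_fun_bounded_iff:
  fixes f :: "real \<Rightarrow> complex"
  assumes \<tau>: "\<tau> > 0" and \<sigma>: "\<sigma> > 1" and d: "d 0 = 0"
  shows "bdd_above (range (\<lambda>x. norm (f x) * exp (assoc_fun \<tau> \<sigma> d \<bar>x\<bar>))) \<longleftrightarrow>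
    (\<exists>C>0. \<forall>n x. norm (of_real (x ^ d n) * f x) \<le> C * weight \<tau> \<sigma> (d n))"
proof -
  define t where "t = (\<lambda>x n. ln (\<bar>x\<bar> ^ d n / weight \<tau> \<sigma> (d n)))"
  have assoc: "assoc_fun \<tau> \<sigma> d \<bar>x\<bar> = (SUP n. t x n)" for x
    by (simp add: assoc_fun_def t_def)
  note pos = weight_pos[of \<tau> \<sigma>]
  \<comment> \<open>At x = 0 with d n > 0 the convention ln 0 = 0 replaces minus infinity; the case
    distinctions below isolate these terms.\<close>
  have t0: "t x n = 0" if "\<bar>x\<bar> ^ d n = 0" for x n
    unfolding t_def that by simp
  have bdd: "bdd_above (range (t x))" for x
  proof -
    obtain C where C: "C > 0" "\<And>n. \<bar>x\<bar> ^ n \<le> C * weight \<tau> \<sigma> n"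
      using weight_absorb_power[OF \<tau> \<sigma>, of "\<bar>x\<bar>"] by auto
    have "t x n \<le> max 0 (ln C)" for n
    proof (cases "\<bar>x\<bar> ^ d n > 0")
      case True
      then have "\<bar>x\<bar> ^ d n / weight \<tau> \<sigma> (d n) > 0" "\<bar>x\<bar> ^ d n / weight \<tau> \<sigma> (d n) \<le> C"
        using C(2)[of "d n"] pos[of "d n"] by (simp_all add: pos_divide_le_eq)
      then have "t x n \<le> ln C" unfolding t_def using C(1) by (intro ln_mono) auto
      then show ?thesis by simp
    next
      case False
      then have "\<bar>x\<bar> ^ d n = 0" using zero_le_power[of "\<bar>x\<bar>" "d n"] by linarith
      then show ?thesis by (simp only: t0 max.cobounded1)
    qed
    then show ?thesis by (intro bdd_aboveI2)
  qed
  show ?thesis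
  proof
    assume "bdd_above (range (\<lambda>x. norm (f x) * exp (assoc_fun \<tau> \<sigma> d \<bar>x\<bar>)))"
    then obtain B where B: "\<And>x. norm (f x) * exp (assoc_fun \<tau> \<sigma> d \<bar>x\<bar>) \<le> B"
      by (auto simp: bdd_above_def)
    have "norm (of_real (x ^ d n) * f x) \<le> max 1 B * weight \<tau> \<sigma> (d n)" for n x
    proof -
      have "\<bar>x\<bar> ^ d n / weight \<tau> \<sigma> (d n) \<le> exp (t x n)"
      proof (cases "\<bar>x\<bar> ^ d n > 0")
        case True
        then show ?thesis using pos[of "d n"] by (simp add: t_def)
      next
        case False
        then have "\<bar>x\<bar> ^ d n = 0" using zero_le_power[of "\<bar>x\<bar>" "d n"] by linarith
        then show ?thesis by (simp only: div_0 exp_ge_zero)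
      qed
      also have "\<dots> \<le> exp (assoc_fun \<tau> \<sigma> d \<bar>x\<bar>)"
        unfolding assoc using cSUP_upper[OF UNIV_I bdd] by simp
      finally have "norm (f x) * (\<bar>x\<bar> ^ d n / weight \<tau> \<sigma> (d n)) \<le> norm (f x) * exp (assoc_fun \<tau> \<sigma> d \<bar>x\<bar>)"
        by (rule mult_left_mono) simp
      also have "\<dots> \<le> max 1 B" using B[of x] by simp
      finally show ?thesis using pos[of "d n"]
        by (simp add: norm_mult norm_power pos_divide_le_eq mult.commute)
    qed
    then show "\<exists>C>0. \<forall>n x. norm (of_real (x ^ d n) * f x) \<le> C * weight \<tau> \<sigma> (d n)"
      by (intro exI[of _ "max 1 B"]) auto
  next
    assume "\<exists>C>0. \<forall>n x. norm (of_real (x ^ d n) * f x) \<le> C * weight \<tau> \<sigma> (d n)"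
    then obtain C where C: "C > 0" "\<And>n x. norm (of_real (x ^ d n) * f x) \<le> C * weight \<tau> \<sigma> (d n)"
      by blast
    have "norm (f x) * exp (assoc_fun \<tau> \<sigma> d \<bar>x\<bar>) \<le> C" for x
    proof (cases "f x = 0")
      case False
      then have fx: "norm (f x) > 0" by simp
      \<comment> \<open>Index 0 makes C / norm (f x) at least 1, so its logarithm also dominates the
        terms that are 0 only by convention.\<close>
      have fC: "norm (f x) \<le> C" using C(2)[of x 0] d by (simp add: weight_def)
      have "assoc_fun \<tau> \<sigma> d \<bar>x\<bar> \<le> ln (C / norm (f x))"
        unfolding assoc
      proof (rule cSUP_least)
        fix n
        show "t x n \<le> ln (C / norm (f x))"
        proof (cases "\<bar>x\<bar> ^ d n > 0")
          case True
          have "\<bar>x\<bar> ^ d n * norm (f x) \<le> C * weight \<tau> \<sigma> (d n)"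
            using C(2)[of x n] by (simp add: norm_mult norm_power)
          then have "\<bar>x\<bar> ^ d n / weight \<tau> \<sigma> (d n) \<le> C / norm (f x)"
            using fx pos[of "d n"] by (simp add: divide_le_eq field_simps)
          then show ?thesis unfolding t_def using True pos[of "d n"] by (intro ln_mono) auto
        next
          case False
          then have "\<bar>x\<bar> ^ d n = 0" using zero_le_power[of "\<bar>x\<bar>" "d n"] by linarith
          then have "t x n = 0" by (rule t0)
          also have "0 \<le> ln (C / norm (f x))" using fx fC by simp
          finally show ?thesis .
        qed
      qed simp
      then have "exp (assoc_fun \<tau> \<sigma> d \<bar>x\<bar>) \<le> exp (ln (C / norm (f x)))" by simp
      also have "\<dots> = C / norm (f x)" using C(1) fx by simp
      finally show ?thesis using fx by (simp add: field_simps)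
    qed (use C(1) in simp)
    then show "bdd_above (range (\<lambda>x. norm (f x) * exp (assoc_fun \<tau> \<sigma> d \<bar>x\<bar>)))"
      by (intro bdd_aboveI2)
  qed
qed

lemma cond_assoc_fun_iff:
  assumes "\<sigma> > 1"
  shows "cond_assoc_fun \<sigma> \<phi> \<longleftrightarrow> cond_decay_decay \<sigma> \<phi>"
proof -
  have "(bdd_above (range (\<lambda>x. norm (\<phi> x) * exp (assoc_fun \<tau> \<sigma> \<alpha> \<bar>x\<bar>))) \<and>
      bdd_above (range (\<lambda>\<xi>. norm (fourier \<phi> \<xi>) * exp (assoc_fun \<tau> \<sigma> \<beta> \<bar>\<xi>\<bar>)))) \<longleftrightarrow>
    (\<exists>C>0. \<forall>m n. (\<forall>x. norm (of_real (x ^ \<alpha> n) * \<phi> x) \<le> C * weight \<tau> \<sigma> (\<alpha> n)) \<and>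
           (\<forall>\<xi>. norm (of_real (\<xi> ^ \<beta> m) * fourier \<phi> \<xi>) \<le> C * weight \<tau> \<sigma> (\<beta> m)))" (is "?l \<longleftrightarrow> ?r")
    if "admissible \<alpha> \<beta>" "\<tau> > 0" for \<alpha> \<beta> \<tau>
  proof -
    have 0: "\<alpha> 0 = 0" "\<beta> 0 = 0" using that by (auto simp: admissible_def)
    show ?thesis
      unfolding assoc_fun_bounded_iff[where d=\<alpha>, OF that(2) assms 0(1)] assoc_fun_bounded_iff[where d=\<beta>, OF that(2) assms 0(2)]
    proof
      assume "(\<exists>C>0. \<forall>n x. norm (of_real (x ^ \<alpha> n) * \<phi> x) \<le> C * weight \<tau> \<sigma> (\<alpha> n)) \<and>
        (\<exists>C>0. \<forall>n x. norm (of_real (x ^ \<beta> n) * fourier \<phi> x) \<le> C * weight \<tau> \<sigma> (\<beta> n))"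
      then obtain C D where C: "C > 0" "\<And>n x. norm (of_real (x ^ \<alpha> n) * \<phi> x) \<le> C * weight \<tau> \<sigma> (\<alpha> n)"
        and D: "D > 0" "\<And>n x. norm (of_real (x ^ \<beta> n) * fourier \<phi> x) \<le> D * weight \<tau> \<sigma> (\<beta> n)"
        by blast
      have "C * weight \<tau> \<sigma> n \<le> (C + D) * weight \<tau> \<sigma> n" "D * weight \<tau> \<sigma> n \<le> (C + D) * weight \<tau> \<sigma> n" for n
        using C(1) D(1) weight_pos[of \<tau> \<sigma> n] by (auto intro!: mult_right_mono)
      then have "norm (of_real (x ^ \<alpha> n) * \<phi> x) \<le> (C + D) * weight \<tau> \<sigma> (\<alpha> n)"
        "norm (of_real (x ^ \<beta> n) * fourier \<phi> x) \<le> (C + D) * weight \<tau> \<sigma> (\<beta> n)" for n x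
        using C(2) D(2) order_trans by blast+
      then show ?r using C(1) D(1) by (intro exI[of _ "C + D"]) (simp add: add_pos_pos)
    qed blast
  qed
  then show ?thesis unfolding cond_assoc_fun_def cond_decay_decay_def
    by (intro ex_cong1 conj_cong[OF refl] all_cong1 imp_cong[OF refl])
qed

theorem theorem4p7:
  fixes \<sigma> :: real and \<phi> :: "real \<Rightarrow> complex"
  assumes "\<sigma> > 1" and "smooth \<phi>"
  shows "(\<phi> \<in> gelfand_shilov \<sigma> \<longleftrightarrow> cond_decay_deriv \<sigma> \<phi>) \<and>
         (\<phi> \<in> gelfand_shilov \<sigma> \<longleftrightarrow> cond_decay_decay \<sigma> \<phi>) \<and>
         (\<phi> \<in> gelfand_shilov \<sigma> \<longleftrightarrow> cond_fourier \<sigma> \<phi>) \<and>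
         (\<phi> \<in> gelfand_shilov \<sigma> \<longleftrightarrow> cond_assoc_fun \<sigma> \<phi>)"
proof -
  let ?g = "fourier \<phi>"
  have meas: "\<phi> \<in> borel_measurable borel" by (rule smooth_borel_measurable[OF assms(2)])
  have forward: "cond_decay_deriv \<sigma> \<phi>" "cond_decay_decay \<sigma> \<phi>" "cond_fourier \<sigma> \<phi>"
    if \<phi>: "\<phi> \<in> gelfand_shilov \<sigma>"
  proof -
    note D = gelfand_shilovD[OF \<phi>] and G = gelfand_shilovD[OF fourier_gelfand_shilov[OF assms(1) \<phi>]]
    show "cond_decay_deriv \<sigma> \<phi>" unfolding cond_decay_deriv_def
      using weight_bounded_pair[OF D(2,3)] admissible_identity by (intro exI conjI) auto
    show "cond_decay_decay \<sigma> \<phi>" unfolding cond_decay_decay_def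
      using weight_bounded_pair[OF D(2) G(2)] admissible_identity by (intro exI conjI) auto
    show "cond_fourier \<sigma> \<phi>" unfolding cond_fourier_def
      using weight_bounded_pair[OF G(3) G(2)] admissible_identity G(1) fourier_of_decays(1)[OF assms(1) meas D(2)]
      by (intro exI conjI) auto
  qed
  \<comment> \<open>Decay of the transform supplies its integrability, smoothness of \<phi> the
    continuity.\<close>
  have inversion: "\<phi> = (\<lambda>x. fourier ?g (- x))" if "integrable lborel \<phi>" "smooth ?g" "decays \<sigma> ?g"
    using fourier_inversion[OF that(1) fourier_of_decays(1)[OF assms(1) smooth_borel_measurable[OF that(2)] that(3)]]
      smooth_isCont[OF assms(2)] by (intro ext) auto
  have 2: "\<phi> \<in> gelfand_shilov \<sigma>" if c: "cond_decay_deriv \<sigma> \<phi>"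
  proof -
    obtain \<alpha> \<beta> where adm: "admissible \<alpha> \<beta>" and b: "\<And>\<tau>. \<tau> > 0 \<Longrightarrow> \<exists>C>0. \<forall>m n.
           (\<forall>x. norm (of_real (x ^ \<alpha> n) * \<phi> x) \<le> C * weight \<tau> \<sigma> (\<alpha> n)) \<and>
           (\<forall>x. norm (nth_deriv (\<beta> m) \<phi> x) \<le> C * weight \<tau> \<sigma> (\<beta> m))"
      using c unfolding cond_decay_deriv_def by blast
    obtain L where L: "strict_mono \<alpha>" "\<alpha> 0 = 0" "gap_bounded \<alpha> L" "strict_mono \<beta>" "\<beta> 0 = 0" "gap_bounded \<beta> L"
      using adm by (rule admissibleD)
    have b1: "\<exists>C>0. \<forall>n x. norm (of_real (x ^ \<alpha> n) * \<phi> x) \<le> C * weight \<tau> \<sigma> (\<alpha> n)" and b2: "\<exists>C>0. \<forall>n x. norm (nth_deriv (\<beta> n) \<phi> x) \<le> C * weight \<tau> \<sigma> (\<beta> n)"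
      if "\<tau> > 0" for \<tau> using b[OF that] by blast+
    have "decays \<sigma> \<phi>" by (rule decays_from_subsequence[OF assms(1) L(1-3)]) (rule b1)
    moreover have "derivs_bounded \<sigma> \<phi>"
      by (rule derivs_bounded_from_subsequence[OF assms(1) L(4-6) assms(2)]) (rule b2)
    ultimately show ?thesis using assms by (intro gelfand_shilovI)
  qed
  have 3: "\<phi> \<in> gelfand_shilov \<sigma>" if c: "cond_decay_decay \<sigma> \<phi>"
  proof -
    obtain \<alpha> \<beta> where adm: "admissible \<alpha> \<beta>" and b: "\<And>\<tau>. \<tau> > 0 \<Longrightarrow> \<exists>C>0. \<forall>m n.
           (\<forall>x. norm (of_real (x ^ \<alpha> n) * \<phi> x) \<le> C * weight \<tau> \<sigma> (\<alpha> n)) \<and>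
           (\<forall>\<xi>. norm (of_real (\<xi> ^ \<beta> m) * ?g \<xi>) \<le> C * weight \<tau> \<sigma> (\<beta> m))"
      using c unfolding cond_decay_decay_def by blast
    obtain L where L: "strict_mono \<alpha>" "\<alpha> 0 = 0" "gap_bounded \<alpha> L" "strict_mono \<beta>" "\<beta> 0 = 0" "gap_bounded \<beta> L"
      using adm by (rule admissibleD)
    have b1: "\<exists>C>0. \<forall>n x. norm (of_real (x ^ \<alpha> n) * \<phi> x) \<le> C * weight \<tau> \<sigma> (\<alpha> n)" and b2: "\<exists>C>0. \<forall>n x. norm (of_real (x ^ \<beta> n) * ?g x) \<le> C * weight \<tau> \<sigma> (\<beta> n)"
      if "\<tau> > 0" for \<tau> using b[OF that] by blast+
    have d: "decays \<sigma> \<phi>" by (rule decays_from_subsequence[OF assms(1) L(1-3)]) (rule b1)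
    have g: "decays \<sigma> ?g" by (rule decays_from_subsequence[OF assms(1) L(4-6)]) (rule b2)
    \<comment> \<open>Decay of \<phi> makes the transform smooth and thereby measurable, so its own
      decay can be used to bound the derivatives of the second transform, which is \<phi>
      reflected.\<close>
    note F = fourier_of_decays[OF assms(1) meas d]
    note F' = fourier_of_decays[OF assms(1) smooth_borel_measurable[OF F(2)] g]
    have "derivs_bounded \<sigma> (\<lambda>x. fourier ?g (- x))"
      by (rule derivs_bounded_reflect[OF F'(2,3)])
    then have "derivs_bounded \<sigma> \<phi>" by (subst inversion[OF F(1,2) g])
    then show ?thesis using assms d by (intro gelfand_shilovI)
  qed
  have 4: "\<phi> \<in> gelfand_shilov \<sigma>" if c: "cond_fourier \<sigma> \<phi>"
  proof -
    obtain \<alpha> \<beta> where int: "integrable lborel \<phi>" and sm: "smooth ?g"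
      and adm: "admissible \<alpha> \<beta>" and b: "\<And>\<tau>. \<tau> > 0 \<Longrightarrow> \<exists>C>0. \<forall>m n.
           (\<forall>\<xi>. norm (nth_deriv (\<alpha> n) ?g \<xi>) \<le> C * weight \<tau> \<sigma> (\<alpha> n)) \<and>
           (\<forall>\<xi>. norm (of_real (\<xi> ^ \<beta> m) * ?g \<xi>) \<le> C * weight \<tau> \<sigma> (\<beta> m))"
      using c unfolding cond_fourier_def by blast
    obtain L where L: "strict_mono \<alpha>" "\<alpha> 0 = 0" "gap_bounded \<alpha> L" "strict_mono \<beta>" "\<beta> 0 = 0" "gap_bounded \<beta> L"
      using adm by (rule admissibleD)
    have b1: "\<exists>C>0. \<forall>n x. norm (nth_deriv (\<alpha> n) ?g x) \<le> C * weight \<tau> \<sigma> (\<alpha> n)" and b2: "\<exists>C>0. \<forall>n x. norm (of_real (x ^ \<beta> n) * ?g x) \<le> C * weight \<tau> \<sigma> (\<beta> n)"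
      if "\<tau> > 0" for \<tau> using b[OF that] by blast+
    have g: "decays \<sigma> ?g" by (rule decays_from_subsequence[OF assms(1) L(4-6)]) (rule b2)
    have "derivs_bounded \<sigma> ?g"
      by (rule derivs_bounded_from_subsequence[OF assms(1) L(1-3) sm]) (rule b1)
    \<comment> \<open>All data concern the transform, so membership is shown for it, passed to the
      second transform, and carried to \<phi> by inversion and reflection.\<close>
    then have "?g \<in> gelfand_shilov \<sigma>" using assms(1) sm g by (intro gelfand_shilovI)
    note G = gelfand_shilovD[OF fourier_gelfand_shilov[OF assms(1) this]]
    have "decays \<sigma> \<phi>"
      by (subst inversion[OF int sm g]) (rule decays_reflect[OF G(2)])
    moreover have "derivs_bounded \<sigma> \<phi>"
      by (subst inversion[OF int sm g]) (rule derivs_bounded_reflect[OF G(1,3)])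
    ultimately show ?thesis using assms by (intro gelfand_shilovI)
  qed
  show ?thesis using forward 2 3 4 cond_assoc_fun_iff[OF assms(1)] by blast
qed

end
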